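(* Let $X\subseteq\mathbb{R}^2$ be a finite union of sets of the form $$\{\Phi_{g_1,\theta_1}=0\}\cap\cdots\cap\{\Phi_{g_m,\theta_m}=0\}\cap\{\Phi_{f_1,\beta_1}>0\}\cap\cdots\cap\{\Phi_{f_k,\beta_k}>0\},$$ where $g_i,f_j$ are real polynomials in one variable and $\theta_i,\beta_j$ are angles. Then there exists a cell decomposition of $X$ such that every shortest-length curve between two points of $X$ interacts with each cell at most finitely many times.
   Context: For a real polynomial $p$ and angle $\theta$, $\Phi_{p,\theta}(x,y)=p(x\cos\theta+y\sin\theta)-(-x\sin\theta+y\cos\theta)$; $\{\Phi_{p,\theta}=0\}$ is the graph of $p$ in the coordinate frame rotated by $\theta$, and $\{\Phi_{p,\theta}>0\}$ is the open region below that graph (an open polynomial half plane). A shortest-length curve between $A$ and $B$ in $X$ is a continuous piecewise $C^2$ curve in $X$ from $A$ to $B$ of minimal length $\int|\gamma'|$ among all piecewise $C^2$ curves in $X$ from $A$ to $B$. A cell decomposition of $X$ is a partition of $X$ into at most countably many pairwise disjoint cells, each homeomorphic to $\mathbb{R}^d$, $d\in\{0,1,2\}$. A curve $\gamma$ interacts with a set $e$ at most $N$ times if $\gamma^{-1}(e)$ has at most $N$ connected components. *)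

theory Defs
  imports "HOL-Analysis.Analysis" "HOL-Computational_Algebra.Polynomial"
begin

definition Phi :: "real poly \<Rightarrow> real \<Rightarrow> real \<times> real \<Rightarrow> real" where
  "Phi p \<theta> z = poly p (fst z * cos \<theta> + snd z * sin \<theta>) - (- fst z * sin \<theta> + snd z * cos \<theta>)"

definition basic_set :: "(real poly \<times> real) list \<Rightarrow> (real poly \<times> real) list \<Rightarrow> (real \<times> real) set" where
  "basic_set eqs ineqs =
     {z. (\<forall>(g,\<theta>)\<in>set eqs. Phi g \<theta> z = 0) \<and> (\<forall>(f,\<beta>)\<in>set ineqs. Phi f \<beta> z > 0)}"

definition is_cell :: "(real \<times> real) set \<Rightarrow> bool" where
  "is_cell e \<longleftrightarrow> (\<exists>p. e = {p}) \<or> e homeomorphic (UNIV :: real set)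
                 \<or> e homeomorphic (UNIV :: (real \<times> real) set)"

definition cell_decomposition :: "(real \<times> real) set set \<Rightarrow> (real \<times> real) set \<Rightarrow> bool" where
  "cell_decomposition C X \<longleftrightarrow> countable C \<and> disjoint C \<and> \<Union>C = X \<and> (\<forall>e\<in>C. is_cell e)"

definition C2_on_interval :: "real \<Rightarrow> real \<Rightarrow> (real \<Rightarrow> real \<times> real) \<Rightarrow> bool" where
  "C2_on_interval u v \<gamma> \<longleftrightarrow> (\<exists>g g' g''. (\<forall>t\<in>{u..v}. g t = \<gamma> t)
      \<and> (\<forall>t. (g has_vector_derivative g' t) (at t))
      \<and> (\<forall>t. (g' has_vector_derivative g'' t) (at t))
      \<and> continuous_on UNIV g'')"

definition piecewise_C2 :: "(real \<Rightarrow> real \<times> real) \<Rightarrow> bool" where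
  "piecewise_C2 \<gamma> \<longleftrightarrow> continuous_on {0..1} \<gamma> \<and>
     (\<exists>n::nat. \<exists>t::nat \<Rightarrow> real. t 0 = 0 \<and> t n = 1 \<and> (\<forall>i<n. t i < t (Suc i))
        \<and> (\<forall>i<n. C2_on_interval (t i) (t (Suc i)) \<gamma>))"

definition curve_length :: "(real \<Rightarrow> real \<times> real) \<Rightarrow> real" where
  "curve_length \<gamma> = integral {0..1} (\<lambda>t. norm (vector_derivative \<gamma> (at t)))"

definition curve_in :: "(real \<times> real) set \<Rightarrow> real \<times> real \<Rightarrow> real \<times> real \<Rightarrow> (real \<Rightarrow> real \<times> real) \<Rightarrow> bool" where
  "curve_in X A B \<gamma> \<longleftrightarrow> piecewise_C2 \<gamma> \<and> \<gamma> ` {0..1} \<subseteq> X \<and> \<gamma> 0 = A \<and> \<gamma> 1 = B"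

definition shortest_curve :: "(real \<times> real) set \<Rightarrow> real \<times> real \<Rightarrow> real \<times> real \<Rightarrow> (real \<Rightarrow> real \<times> real) \<Rightarrow> bool" where
  "shortest_curve X A B \<gamma> \<longleftrightarrow> curve_in X A B \<gamma> \<and>
     (\<forall>\<eta>. curve_in X A B \<eta> \<longrightarrow> curve_length \<gamma> \<le> curve_length \<eta>)"

definition interacts_finitely :: "(real \<Rightarrow> real \<times> real) \<Rightarrow> (real \<times> real) set \<Rightarrow> bool" where
  "interacts_finitely \<gamma> e \<longleftrightarrow> finite (components {t\<in>{0..1}. \<gamma> t \<in> e})"

end

theory Submission
  imports Defs
begin

text \<open>A convex cell inside \<open>X\<close> is met in at most one interval of time, because the chord between
  two of its points is the unique shortest curve between them. As countably many cells are allowed,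
  the open part of \<open>X\<close> off all the zero curves is cut into dyadic squares, edges and vertices. What
  is left lies on finitely many polynomial graphs, and apart from finitely many points it is cut
  into short arcs on which the graph is linear or has curvature of constant sign, with each side
  locally inside or locally outside \<open>X\<close>. Near a curved arc a multiple of \<open>Phi p \<theta>\<close> is strictly
  quasiconcave; it is positive on the convex side. If that side lies in \<open>X\<close>, chords of the arc lie
  in \<open>X\<close> and a shortest curve meets the arc in at most two points. Otherwise a shortest curve
  between two points of the arc cannot leave it: the convex side is closed to it, and a lowest point
  on the other side would be interior to a straight piece of the curve.\<close>

section \<open>Piecewise smooth curves and their length\<close>

definition C2_curve :: "(real \<Rightarrow> 'a::real_normed_vector) \<Rightarrow> bool" where
  "C2_curve g \<longleftrightarrow> (\<exists>g' g''. (\<forall>t. (g has_vector_derivative g' t) (at t))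
      \<and> (\<forall>t. (g' has_vector_derivative g'' t) (at t)) \<and> continuous_on UNIV g'')"

definition speed :: "(real \<Rightarrow> 'a::real_normed_vector) \<Rightarrow> real \<Rightarrow> real" where
  "speed \<gamma> t = norm (vector_derivative \<gamma> (at t))"

definition arc_length :: "(real \<Rightarrow> 'a::real_normed_vector) \<Rightarrow> real \<Rightarrow> real \<Rightarrow> real" where
  "arc_length \<gamma> s t = integral {s..t} (speed \<gamma>)"

inductive piecewise_C2_on :: "(real \<Rightarrow> real \<times> real) \<Rightarrow> real \<Rightarrow> real \<Rightarrow> bool" for \<gamma> where
  refl: "piecewise_C2_on \<gamma> a a"
| step: "C2_on_interval a b \<gamma> \<Longrightarrow> a < b \<Longrightarrow> piecewise_C2_on \<gamma> b c \<Longrightarrow> piecewise_C2_on \<gamma> a c"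

lemma C2_curve_has_vector_derivative:
  "C2_curve g \<Longrightarrow> (g has_vector_derivative vector_derivative g (at t)) (at t)"
  unfolding C2_curve_def by (metis vector_derivative_at)

lemma continuous_on_C2_curve: "C2_curve g \<Longrightarrow> continuous_on S g"
  by (intro continuous_at_imp_continuous_on ballI
      has_vector_derivative_continuous[OF C2_curve_has_vector_derivative])

lemma continuous_on_speed:
  assumes "C2_curve g"
  shows "continuous_on S (speed g)"
proof -
  obtain g' g'' where g: "\<And>t. (g has_vector_derivative g' t) (at t)"
      "\<And>t. (g' has_vector_derivative g'' t) (at t)"
    using assms unfolding C2_curve_def by blast
  have "continuous_on S g'"
    by (intro continuous_at_imp_continuous_on ballI has_vector_derivative_continuous[OF g(2)])
  then show ?thesis
    unfolding speed_def vector_derivative_at[OF g(1)] by (rule continuous_on_norm)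
qed

lemma
  assumes "C2_curve g"
  shows C2_curve_affine: "C2_curve (\<lambda>r. g (k * r + x))"
    and speed_affine: "speed (\<lambda>r. g (k * r + x)) r = \<bar>k\<bar> * speed g (k * r + x)"
proof -
  have chain: "((\<lambda>r. f (k * r + x)) has_vector_derivative k *\<^sub>R d) (at r)"
    if "(f has_vector_derivative d) (at (k * r + x))" for f :: "real \<Rightarrow> 'a" and d r
  proof -
    have "((\<lambda>r. k * r + x) has_vector_derivative k) (at r)"
      by (auto intro!: derivative_eq_intros
          simp flip: has_real_derivative_iff_has_vector_derivative)
    from vector_diff_chain_at[OF this that] show ?thesis by (simp add: comp_def)
  qed
  obtain g' g'' where g: "\<And>t. (g has_vector_derivative g' t) (at t)"
      "\<And>t. (g' has_vector_derivative g'' t) (at t)" "continuous_on UNIV g''"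
    using assms unfolding C2_curve_def by blast
  have "continuous_on UNIV (\<lambda>r. k *\<^sub>R k *\<^sub>R g'' (k * r + x))"
    by (intro continuous_intros continuous_on_compose2[OF g(3)]) auto
  moreover have "((\<lambda>r. k *\<^sub>R g' (k * r + x)) has_vector_derivative
      k *\<^sub>R k *\<^sub>R g'' (k * r + x)) (at r)" for r
    by (rule bounded_linear.has_vector_derivative[OF bounded_linear_scaleR_right chain[OF g(2)]])
  ultimately show "C2_curve (\<lambda>r. g (k * r + x))"
    unfolding C2_curve_def using chain[OF g(1)]
    by (intro exI[of _ "\<lambda>r. k *\<^sub>R g' (k * r + x)"] exI[of _ "\<lambda>r. k *\<^sub>R k *\<^sub>R g'' (k * r + x)"]) simp
  show "speed (\<lambda>r. g (k * r + x)) r = \<bar>k\<bar> * speed g (k * r + x)"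
    unfolding speed_def vector_derivative_at[OF chain[OF g(1)]] vector_derivative_at[OF g(1)]
    by simp
qed

lemma C2_on_interval_iff: "C2_on_interval u v \<gamma> \<longleftrightarrow> (\<exists>g. C2_curve g \<and> (\<forall>t\<in>{u..v}. g t = \<gamma> t))"
  unfolding C2_on_interval_def C2_curve_def by blast

lemma C2_on_interval_mono:
  assumes "C2_on_interval u v \<gamma>" "{u'..v'} \<subseteq> {u..v}" "\<And>r. r \<in> {u'..v'} \<Longrightarrow> \<gamma> r = \<eta> r"
  shows "C2_on_interval u' v' \<eta>"
  using assms unfolding C2_on_interval_iff by (metis subsetD)

lemma piecewise_C2_on_le: "piecewise_C2_on \<gamma> a b \<Longrightarrow> a \<le> b"
  by (induction rule: piecewise_C2_on.induct) auto

lemma piecewise_C2_on_interval: "C2_on_interval a b \<gamma> \<Longrightarrow> a \<le> b \<Longrightarrow> piecewise_C2_on \<gamma> a b"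
  by (cases "a = b")
     (simp_all add: piecewise_C2_on.refl piecewise_C2_on.step[OF _ _ piecewise_C2_on.refl])

lemma piecewise_C2_on_trans:
  "piecewise_C2_on \<gamma> a b \<Longrightarrow> piecewise_C2_on \<gamma> b c \<Longrightarrow> piecewise_C2_on \<gamma> a c"
proof (induction rule: piecewise_C2_on.induct)
  case (step a a' b)
  show ?case by (rule piecewise_C2_on.step[OF step.hyps(1,2) step.IH[OF step.prems]])
qed

lemma piecewise_C2_on_cong:
  assumes "piecewise_C2_on \<gamma> a b" "\<And>r. r \<in> {a..b} \<Longrightarrow> \<gamma> r = \<eta> r"
  shows "piecewise_C2_on \<eta> a b"
  using assms
proof (induction rule: piecewise_C2_on.induct)
  case (step a b c)
  have "b \<le> c" using step.hyps(3) by (rule piecewise_C2_on_le)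
  then have "C2_on_interval a b \<eta>"
    using step.hyps(2) step.prems by (intro C2_on_interval_mono[OF step.hyps(1)]) auto
  moreover have "piecewise_C2_on \<eta> b c" using step.IH step.prems \<open>a < b\<close> by simp
  ultimately show ?case by (rule piecewise_C2_on.step[OF _ \<open>a < b\<close>])
qed (rule piecewise_C2_on.refl)

lemma piecewise_C2_on_subinterval:
  assumes "piecewise_C2_on \<gamma> a b" "a \<le> s" "s \<le> t" "t \<le> b"
  shows "piecewise_C2_on \<gamma> s t"
  using assms
proof (induction arbitrary: s rule: piecewise_C2_on.induct)
  case (refl a)
  then have "s = t" by simp
  then show ?case by (simp add: piecewise_C2_on.refl)
next
  case (step a b c)
  have head: "piecewise_C2_on \<gamma> s (min b t)" if "s \<le> b"
    using step.prems step.hyps(2) that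
    by (intro piecewise_C2_on_interval C2_on_interval_mono[OF step.hyps(1)]) auto
  consider "t \<le> b" | "s \<le> b" "b \<le> t" | "b \<le> s" by linarith
  then show ?case
  proof cases
    assume "t \<le> b"
    then show ?thesis using head step.prems(2) by simp
  next
    assume "s \<le> b" "b \<le> t"
    then have "piecewise_C2_on \<gamma> s b" using head by simp
    moreover have "piecewise_C2_on \<gamma> b t" using step.IH[of b] \<open>b \<le> t\<close> step.prems by simp
    ultimately show ?thesis by (rule piecewise_C2_on_trans)
  next
    assume "b \<le> s"
    then show ?thesis using step.IH step.prems by simp
  qed
qed

lemma piecewise_C2_on_partition:
  fixes t :: "nat \<Rightarrow> real"
  assumes "\<And>i. i < n \<Longrightarrow> t i < t (Suc i)" "\<And>i. i < n \<Longrightarrow> C2_on_interval (t i) (t (Suc i)) \<gamma>"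
    and "i \<le> n"
  shows "piecewise_C2_on \<gamma> (t i) (t n)"
  using assms(3)
proof (induction rule: inc_induct)
  case (step i)
  show ?case by (rule piecewise_C2_on.step[OF assms(2,1)[OF step.hyps(2)] step.IH])
qed (rule piecewise_C2_on.refl)

lemma piecewise_C2_on_obtain_partition:
  assumes "piecewise_C2_on \<gamma> a b"
  obtains n and t :: "nat \<Rightarrow> real" where "t 0 = a" "t n = b" "\<And>i. i < n \<Longrightarrow> t i < t (Suc i)"
    "\<And>i. i < n \<Longrightarrow> C2_on_interval (t i) (t (Suc i)) \<gamma>"
  using assms
proof (induction arbitrary: thesis rule: piecewise_C2_on.induct)
  case (refl a)
  show ?case by (rule refl.prems[of "\<lambda>_. a" 0]) simp_all
next
  case (step a b c)
  obtain n t where t: "t 0 = b" "t n = c" "\<And>i. i < n \<Longrightarrow> t i < t (Suc i)"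
    "\<And>i. i < n \<Longrightarrow> C2_on_interval (t i) (t (Suc i)) \<gamma>"
    using step.IH by blast
  have "case_nat a t i < case_nat a t (Suc i)
      \<and> C2_on_interval (case_nat a t i) (case_nat a t (Suc i)) \<gamma>" if "i < Suc n" for i
    using step.hyps(1,2) t that by (cases i) simp_all
  then show ?case using t(2) by (intro step.prems[of "case_nat a t" "Suc n"]) simp_all
qed

lemma piecewise_C2_iff: "piecewise_C2 \<gamma> \<longleftrightarrow> continuous_on {0..1} \<gamma> \<and> piecewise_C2_on \<gamma> 0 1"
proof (intro iffI conjI)
  assume smooth: "piecewise_C2 \<gamma>"
  then show "continuous_on {0..1} \<gamma>" unfolding piecewise_C2_def by (rule conjunct1)
  obtain n t where "t (0::nat) = (0::real)" "t n = 1" "\<forall>i<n. t i < t (Suc i)"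
      "\<forall>i<n. C2_on_interval (t i) (t (Suc i)) \<gamma>"
    using smooth unfolding piecewise_C2_def by blast
  then show "piecewise_C2_on \<gamma> 0 1" using piecewise_C2_on_partition[of n t \<gamma> 0] by simp
next
  assume smooth: "continuous_on {0..1} \<gamma> \<and> piecewise_C2_on \<gamma> 0 1"
  then obtain n t where "t (0::nat) = 0" "t n = 1" "\<forall>i<n. t i < t (Suc i)"
      "\<forall>i<n. C2_on_interval (t i) (t (Suc i)) \<gamma>"
    using piecewise_C2_on_obtain_partition[of \<gamma> 0 1] by metis
  then show "piecewise_C2 \<gamma>" unfolding piecewise_C2_def using smooth by blast
qed

lemma speed_cong:
  assumes "r \<in> {s<..<t}" "\<And>r. r \<in> {s<..<t} \<Longrightarrow> \<gamma> r = \<eta> r"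
  shows "speed \<gamma> r = speed \<eta> r"
proof -
  have "eventually (\<lambda>r. r \<in> UNIV \<longrightarrow> \<gamma> r = \<eta> r) (nhds r)"
    using eventually_nhds_in_open[OF open_greaterThanLessThan assms(1)] assms(2)
    by (auto elim: eventually_mono)
  then show ?thesis unfolding speed_def by (simp add: vector_derivative_cong_eq)
qed

lemma arc_length_cong:
  assumes "\<And>r. r \<in> {s<..<t} \<Longrightarrow> \<gamma> r = \<eta> r"
  shows "arc_length \<gamma> s t = arc_length \<eta> s t"
  unfolding arc_length_def
  by (rule integral_spike[of "{s,t}"]) (auto intro!: speed_cong[of _ s t] simp: assms)

lemma arc_length_refl [simp]: "arc_length \<gamma> a a = 0"
  unfolding arc_length_def by simp

lemma C2_on_interval_speed_integrable:
  assumes "C2_on_interval u v \<gamma>"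
  shows "speed \<gamma> integrable_on {u..v}"
proof -
  obtain g where g: "C2_curve g" "\<And>t. t \<in> {u..v} \<Longrightarrow> g t = \<gamma> t"
    using assms unfolding C2_on_interval_iff by blast
  have "speed g integrable_on {u..v}"
    by (intro integrable_continuous_interval continuous_on_speed g(1))
  then show ?thesis
    by (rule integrable_spike[where S = "{u,v}"]) (auto intro!: speed_cong[of _ u v] simp: g(2))
qed

lemma piecewise_C2_on_speed_integrable:
  "piecewise_C2_on \<gamma> a b \<Longrightarrow> speed \<gamma> integrable_on {a..b}"
proof (induction rule: piecewise_C2_on.induct)
  case (refl a)
  show ?case using integrable_on_refl[of "speed \<gamma>" a] by simp
next
  case (step a b c)
  show ?case
    using step.hyps(2) piecewise_C2_on_le[OF step.hyps(3)]
    by (intro Henstock_Kurzweil_Integration.integrable_combine[OF _ _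
          C2_on_interval_speed_integrable[OF step.hyps(1)] step.IH]) simp_all
qed

lemma arc_length_combine:
  assumes "piecewise_C2_on \<gamma> a c" "a \<le> b" "b \<le> c"
  shows "arc_length \<gamma> a b + arc_length \<gamma> b c = arc_length \<gamma> a c"
  unfolding arc_length_def
  using piecewise_C2_on_speed_integrable[OF assms(1)] assms(2,3)
  by (intro Henstock_Kurzweil_Integration.integral_combine)

lemma C2_curve_dist_le_arc_length:
  fixes g :: "real \<Rightarrow> 'a::banach"
  assumes "C2_curve g" "a \<le> b"
  shows "dist (g a) (g b) \<le> arc_length g a b"
proof -
  let ?g' = "\<lambda>r. vector_derivative g (at r)"
  have deriv: "(?g' has_integral (g b - g a)) {a..b}"
    using C2_curve_has_vector_derivative[OF assms(1)] assms(2)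
    by (intro fundamental_theorem_of_calculus) (auto intro: has_vector_derivative_at_within)
  then have "?g' integrable_on {a..b}" by (rule has_integral_integrable)
  moreover have "speed g integrable_on {a..b}"
    by (intro integrable_continuous_interval continuous_on_speed assms(1))
  ultimately have "norm (integral {a..b} ?g') \<le> integral {a..b} (speed g)"
    by (intro integral_norm_bound_integral) (auto simp: speed_def)
  then show ?thesis
    unfolding arc_length_def integral_unique[OF deriv] by (simp add: dist_norm norm_minus_commute)
qed

lemma dist_le_arc_length: "piecewise_C2_on \<gamma> a b \<Longrightarrow> dist (\<gamma> a) (\<gamma> b) \<le> arc_length \<gamma> a b"
proof (induction rule: piecewise_C2_on.induct)
  case (step a b c)
  obtain g where g: "C2_curve g" "\<And>t. t \<in> {a..b} \<Longrightarrow> g t = \<gamma> t"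
    using step.hyps(1) unfolding C2_on_interval_iff by blast
  have "dist (\<gamma> a) (\<gamma> b) \<le> arc_length g a b"
    using C2_curve_dist_le_arc_length[OF g(1), of a b] step.hyps(2) g(2) by simp
  also have "arc_length g a b = arc_length \<gamma> a b" by (rule arc_length_cong) (simp add: g(2))
  finally have "dist (\<gamma> a) (\<gamma> c) \<le> arc_length \<gamma> a b + arc_length \<gamma> b c"
    using step.IH dist_triangle[of "\<gamma> a" "\<gamma> c" "\<gamma> b"] by linarith
  also have "\<dots> = arc_length \<gamma> a c"
    using piecewise_C2_on_le[OF step.hyps(3)] step.hyps(2)
    by (intro arc_length_combine[OF piecewise_C2_on.step[OF step.hyps]]) simp_all
  finally show ?case .
qed simp

lemma C2_curve_reparametrize:
  assumes "C2_curve c" "s < t" and speed_le: "\<And>z. z \<in> closed_segment x y \<Longrightarrow> speed c z \<le> M"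
  obtains \<eta> where "C2_curve \<eta>" "\<eta> ` {s..t} \<subseteq> c ` closed_segment x y" "\<eta> s = c x" "\<eta> t = c y"
    "arc_length \<eta> s t \<le> M * \<bar>y - x\<bar>"
proof
  define k where "k = (y - x) / (t - s)"
  define \<eta> where "\<eta> r = c (k * r + (x - k * s))" for r
  have range: "k * r + (x - k * s) \<in> closed_segment x y" if "r \<in> {s..t}" for r
  proof -
    define l where "l = (r - s) / (t - s)"
    have "k * r + (x - k * s) = (1 - l) *\<^sub>R x + l *\<^sub>R y"
      unfolding k_def l_def using \<open>s < t\<close> by (simp add: field_simps)
    moreover have "0 \<le> l" "l \<le> 1" unfolding l_def using that \<open>s < t\<close> by auto
    ultimately show ?thesis unfolding in_segment by blast
  qed
  show C2: "C2_curve \<eta>" unfolding \<eta>_def by (rule C2_curve_affine[OF assms(1)])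
  show "\<eta> ` {s..t} \<subseteq> c ` closed_segment x y" unfolding \<eta>_def using range by auto
  have "k * (t - s) = y - x" unfolding k_def using \<open>s < t\<close> by simp
  then have "k * t + (x - k * s) = y" by (simp add: algebra_simps)
  then show "\<eta> s = c x" "\<eta> t = c y" unfolding \<eta>_def by simp_all
  have "arc_length \<eta> s t \<le> integral {s..t} (\<lambda>_. \<bar>k\<bar> * M)"
    unfolding arc_length_def
  proof (rule integral_le)
    show "speed \<eta> integrable_on {s..t}"
      by (intro integrable_continuous_interval continuous_on_speed C2)
    show "speed \<eta> r \<le> \<bar>k\<bar> * M" if "r \<in> {s..t}" for r
      unfolding \<eta>_def speed_affine[OF assms(1)]
      by (intro mult_left_mono speed_le range that) simp
  qed (rule integrable_const_ivl)
  also have "\<dots> = M * \<bar>y - x\<bar>" unfolding k_def using \<open>s < t\<close> by (simp add: abs_divide)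
  finally show "arc_length \<eta> s t \<le> M * \<bar>y - x\<bar>" .
qed

section \<open>Shortest curves\<close>

lemma curve_length_split:
  assumes "piecewise_C2 \<gamma>" "0 \<le> s" "s \<le> t" "t \<le> 1"
  shows "curve_length \<gamma> = arc_length \<gamma> 0 s + arc_length \<gamma> s t + arc_length \<gamma> t 1"
proof -
  have smooth: "piecewise_C2_on \<gamma> 0 1" using assms(1) by (simp add: piecewise_C2_iff)
  have "arc_length \<gamma> s t + arc_length \<gamma> t 1 = arc_length \<gamma> s 1"
    using assms by (intro arc_length_combine piecewise_C2_on_subinterval[OF smooth]) simp_all
  moreover have "arc_length \<gamma> 0 s + arc_length \<gamma> s 1 = arc_length \<gamma> 0 1"
    using assms by (intro arc_length_combine[OF smooth]) simp_all
  moreover have "curve_length \<gamma> = arc_length \<gamma> 0 1"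
    unfolding curve_length_def arc_length_def speed_def ..
  ultimately show ?thesis by simp
qed

definition detour :: "(real \<Rightarrow> 'a) \<Rightarrow> real \<Rightarrow> real \<Rightarrow> (real \<Rightarrow> 'a) \<Rightarrow> real \<Rightarrow> 'a" where
  "detour \<gamma> s t \<eta> r = (if r \<in> {s..t} then \<eta> r else \<gamma> r)"

lemma detour_inside: "r \<in> {s..t} \<Longrightarrow> detour \<gamma> s t \<eta> r = \<eta> r"
  unfolding detour_def by simp

lemma detour_outside:
  assumes "\<eta> s = \<gamma> s" "\<eta> t = \<gamma> t" "r \<le> s \<or> t \<le> r"
  shows "detour \<gamma> s t \<eta> r = \<gamma> r"
  using assms unfolding detour_def by (metis atLeastAtMost_iff order_antisym)

lemma continuous_on_detour:
  fixes \<gamma> \<eta> :: "real \<Rightarrow> 'a::topological_space"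
  assumes "continuous_on {a..b} \<gamma>" "a \<le> s" "s \<le> t" "t \<le> b"
    and "continuous_on {s..t} \<eta>" "\<eta> s = \<gamma> s" "\<eta> t = \<gamma> t"
  shows "continuous_on {a..b} (detour \<gamma> s t \<eta>)"
proof -
  have "continuous_on ({s..t} \<union> ({a..s} \<union> {t..b})) (detour \<gamma> s t \<eta>)"
    unfolding detour_def using assms
    by (intro continuous_on_cases) (auto intro: continuous_on_subset)
  moreover have "{s..t} \<union> ({a..s} \<union> {t..b}) = {a..b}" using assms by auto
  ultimately show ?thesis by simp
qed

lemma piecewise_C2_detour:
  assumes "piecewise_C2 \<gamma>" "0 \<le> s" "s \<le> t" "t \<le> 1"
    and "piecewise_C2_on \<eta> s t" "continuous_on {s..t} \<eta>" "\<eta> s = \<gamma> s" "\<eta> t = \<gamma> t"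
  shows "piecewise_C2 (detour \<gamma> s t \<eta>)"
proof -
  have cont: "continuous_on {0..1} \<gamma>" and smooth: "piecewise_C2_on \<gamma> 0 1"
    using assms(1) by (simp_all add: piecewise_C2_iff)
  let ?\<zeta> = "detour \<gamma> s t \<eta>"
  have outside: "\<gamma> r = ?\<zeta> r" if "r \<le> s \<or> t \<le> r" for r
    using detour_outside[of \<eta> s \<gamma> t r] assms(7,8) that by simp
  have "piecewise_C2_on ?\<zeta> 0 s" "piecewise_C2_on ?\<zeta> t 1"
    using assms(2-4)
    by (auto intro!: piecewise_C2_on_cong[OF piecewise_C2_on_subinterval[OF smooth]] outside)
  moreover have "piecewise_C2_on ?\<zeta> s t"
    by (rule piecewise_C2_on_cong[OF assms(5)]) (simp add: detour_inside)
  ultimately have "piecewise_C2_on ?\<zeta> 0 1" using piecewise_C2_on_trans by metis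
  then show ?thesis
    unfolding piecewise_C2_iff using continuous_on_detour[OF cont] assms by blast
qed

lemma shortest_curveD:
  assumes "shortest_curve X A B \<gamma>"
  shows "piecewise_C2 \<gamma>" and "\<gamma> ` {0..1} \<subseteq> X"
    and "0 \<le> s \<Longrightarrow> t \<le> 1 \<Longrightarrow> continuous_on {s..t} \<gamma>"
    and "0 \<le> s \<Longrightarrow> s \<le> t \<Longrightarrow> t \<le> 1 \<Longrightarrow> piecewise_C2_on \<gamma> s t"
proof -
  show smooth: "piecewise_C2 \<gamma>" and "\<gamma> ` {0..1} \<subseteq> X"
    using assms unfolding shortest_curve_def curve_in_def by simp_all
  show "continuous_on {s..t} \<gamma>" if "0 \<le> s" "t \<le> 1"
    using smooth that unfolding piecewise_C2_iff by (auto intro: continuous_on_subset)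
  show "piecewise_C2_on \<gamma> s t" if "0 \<le> s" "s \<le> t" "t \<le> 1"
    using smooth that unfolding piecewise_C2_iff by (auto intro: piecewise_C2_on_subinterval)
qed

lemma shortest_curve_arc_length_le:
  assumes "shortest_curve X A B \<gamma>" "0 \<le> s" "s \<le> t" "t \<le> 1"
    and \<eta>: "piecewise_C2_on \<eta> s t" "continuous_on {s..t} \<eta>" "\<eta> ` {s..t} \<subseteq> X" "\<eta> s = \<gamma> s" "\<eta> t = \<gamma> t"
  shows "arc_length \<gamma> s t \<le> arc_length \<eta> s t"
proof -
  let ?\<zeta> = "detour \<gamma> s t \<eta>"
  have outside: "?\<zeta> r = \<gamma> r" if "r \<le> s \<or> t \<le> r" for r
    using detour_outside[of \<eta> s \<gamma> t r] \<eta>(4,5) that by simp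
  have \<zeta>: "piecewise_C2 ?\<zeta>"
    by (rule piecewise_C2_detour[OF shortest_curveD(1)[OF assms(1)] assms(2-4) \<eta>(1,2,4,5)])
  moreover have "?\<zeta> ` {0..1} \<subseteq> X"
    using shortest_curveD(2)[OF assms(1)] \<eta>(3) unfolding detour_def by auto
  moreover have "?\<zeta> 0 = A" "?\<zeta> 1 = B"
    using assms(1-4) outside unfolding shortest_curve_def curve_in_def by simp_all
  ultimately have "curve_in X A B ?\<zeta>" unfolding curve_in_def by simp
  then have "curve_length \<gamma> \<le> curve_length ?\<zeta>" using assms(1) unfolding shortest_curve_def by blast
  moreover have "arc_length ?\<zeta> 0 s = arc_length \<gamma> 0 s" "arc_length ?\<zeta> t 1 = arc_length \<gamma> t 1"
    "arc_length ?\<zeta> s t = arc_length \<eta> s t"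
    by (auto intro!: arc_length_cong outside detour_inside)
  ultimately show ?thesis
    using curve_length_split[OF shortest_curveD(1)[OF assms(1)] assms(2-4)]
      curve_length_split[OF \<zeta> assms(2-4)] by simp
qed

lemma shortest_curve_arc_length_le_C2_curve:
  assumes "shortest_curve X A B \<gamma>" "0 \<le> s" "s \<le> t" "t \<le> 1"
    and c: "C2_curve c" "\<gamma> s = c x" "\<gamma> t = c y" "c ` closed_segment x y \<subseteq> X"
    and speed_le: "\<And>z. z \<in> closed_segment x y \<Longrightarrow> speed c z \<le> M"
  shows "arc_length \<gamma> s t \<le> M * \<bar>y - x\<bar>"
proof (cases "s = t")
  case True
  have "0 \<le> speed c x" unfolding speed_def by simp
  also have "\<dots> \<le> M" by (rule speed_le) simp
  finally show ?thesis using True by simp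
next
  case False
  then have "s < t" using assms(3) by simp
  obtain \<eta> where \<eta>: "C2_curve \<eta>" "\<eta> ` {s..t} \<subseteq> c ` closed_segment x y" "\<eta> s = c x" "\<eta> t = c y"
    "arc_length \<eta> s t \<le> M * \<bar>y - x\<bar>"
    using C2_curve_reparametrize[OF c(1) \<open>s < t\<close> speed_le] by blast
  have "C2_on_interval s t \<eta>" unfolding C2_on_interval_iff using \<eta>(1) by blast
  then have "arc_length \<gamma> s t \<le> arc_length \<eta> s t"
    using \<eta> c(2-4) assms(3) continuous_on_C2_curve[OF \<eta>(1)]
    by (intro shortest_curve_arc_length_le[OF assms(1-4)] piecewise_C2_on_interval) auto
  then show ?thesis using \<eta>(5) by simp
qed

lemma shortest_curve_dist_le:
  assumes "shortest_curve X A B \<gamma>" "0 \<le> s" "s \<le> r" "r \<le> t" "t \<le> 1"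
  shows "dist (\<gamma> s) (\<gamma> r) + dist (\<gamma> r) (\<gamma> t) \<le> arc_length \<gamma> s t"
proof -
  have smooth: "piecewise_C2_on \<gamma> s r" "piecewise_C2_on \<gamma> r t" "piecewise_C2_on \<gamma> s t"
    using assms by (auto intro: shortest_curveD(4)[OF assms(1)])
  have "dist (\<gamma> s) (\<gamma> r) + dist (\<gamma> r) (\<gamma> t) \<le> arc_length \<gamma> s r + arc_length \<gamma> r t"
    by (intro add_mono dist_le_arc_length smooth)
  also have "\<dots> = arc_length \<gamma> s t" by (rule arc_length_combine[OF smooth(3) assms(3,4)])
  finally show ?thesis .
qed

lemma C2_curve_linepath: "C2_curve (linepath P Q)"
  and speed_linepath: "speed (linepath P Q) x = dist P Q"
proof -
  have deriv: "(linepath P Q has_vector_derivative Q - P) (at x)" for x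
    using has_vector_derivative_linepath_within[of P Q x UNIV] by simp
  show "C2_curve (linepath P Q)"
    unfolding C2_curve_def using deriv
    by (intro exI[of _ "\<lambda>_. Q - P"] exI[of _ "\<lambda>_. 0"]) simp
  show "speed (linepath P Q) x = dist P Q"
    unfolding speed_def vector_derivative_at[OF deriv] by (simp add: dist_norm norm_minus_commute)
qed

lemma shortest_curve_chord:
  assumes "shortest_curve X A B \<gamma>" "0 \<le> s" "s \<le> r" "r \<le> t" "t \<le> 1"
    and "closed_segment (\<gamma> s) (\<gamma> t) \<subseteq> X"
  shows "\<gamma> r \<in> closed_segment (\<gamma> s) (\<gamma> t)"
proof -
  let ?c = "linepath (\<gamma> s) (\<gamma> t)"
  have "?c ` closed_segment 0 1 \<subseteq> X"
    using assms(6) by (simp add: closed_segment_eq_real_ivl linepath_image_01)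
  then have "arc_length \<gamma> s t \<le> dist (\<gamma> s) (\<gamma> t)"
    using assms(3,4) shortest_curve_arc_length_le_C2_curve[OF assms(1,2) _ assms(5)
        C2_curve_linepath, of "\<gamma> s" "\<gamma> t" 0 1]
    by (simp add: speed_linepath linepath_0' linepath_1')
  then have "dist (\<gamma> s) (\<gamma> t) = dist (\<gamma> s) (\<gamma> r) + dist (\<gamma> r) (\<gamma> t)"
    using shortest_curve_dist_le[OF assms(1-5)] dist_triangle[of "\<gamma> s" "\<gamma> t" "\<gamma> r"] by linarith
  then show ?thesis by (simp flip: between between_mem_segment)
qed

lemma shortest_curve_no_return:
  assumes "shortest_curve X A B \<gamma>" "0 \<le> s" "s \<le> r" "r \<le> t" "t \<le> 1" "\<gamma> s = \<gamma> t"
  shows "\<gamma> r = \<gamma> s"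
proof -
  have "\<gamma> t \<in> X" using shortest_curveD(2)[OF assms(1)] assms(2-5) by auto
  then show ?thesis using shortest_curve_chord[OF assms(1-5)] assms(6) by simp
qed

lemma shortest_curve_between:
  assumes "shortest_curve X A B \<gamma>" "0 \<le> s" "s \<le> r" "r \<le> t" "t \<le> 1"
    and f: "continuous_on (\<gamma> ` {s..t}) f" "inj_on f (\<gamma> ` {s..t})"
  shows "f (\<gamma> r) \<in> closed_segment (f (\<gamma> s)) (f (\<gamma> t) :: real)"
proof (rule ccontr)
  let ?y = "\<lambda>q. f (\<gamma> q)"
  assume outside: "?y r \<notin> closed_segment (?y s) (?y t)"
  have cont: "continuous_on {s..t} ?y"
    using shortest_curveD(3)[OF assms(1)] assms(2,5) by (intro continuous_on_compose2[OF f(1)]) auto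
  have crossed: "closed_segment (?y a) (?y b) \<subseteq> ?y ` {a..b}" if "s \<le> a" "a \<le> b" "b \<le> t" for a b
  proof -
    have "connected (?y ` {a..b})"
      using that by (intro connected_continuous_image continuous_on_subset[OF cont]) auto
    then have "convex (?y ` {a..b})" by (metis is_interval_connected_1 is_interval_convex_1)
    then show ?thesis using that by (intro closed_segment_subset) auto
  qed
  have same: "\<gamma> q = \<gamma> q'" if "?y q = ?y q'" "q \<in> {s..t}" "q' \<in> {s..t}" for q q'
    using inj_onD[OF f(2) that(1)] that(2,3) by simp
  have "?y s \<in> closed_segment (?y r) (?y t) \<or> ?y t \<in> closed_segment (?y s) (?y r)"
    using outside by (auto simp: closed_segment_eq_real_ivl split: if_splits)
  then have "\<gamma> r = \<gamma> s \<or> \<gamma> r = \<gamma> t"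
  proof
    assume "?y s \<in> closed_segment (?y r) (?y t)"
    then obtain q where q: "q \<in> {r..t}" "?y s = ?y q" using crossed[of r t] assms(3,4) by auto
    then have "\<gamma> s = \<gamma> q" using same assms(3,4) by simp
    then show ?thesis using shortest_curve_no_return[OF assms(1-3), of q] q(1) assms(5) by auto
  next
    assume "?y t \<in> closed_segment (?y s) (?y r)"
    then obtain q where q: "q \<in> {s..r}" "?y q = ?y t" using crossed[of s r] assms(3,4) by force
    then have "\<gamma> q = \<gamma> t" using same assms(3,4) by simp
    then show ?thesis
      using shortest_curve_no_return[OF assms(1), of q r t] q(1) assms(2,4,5) by auto
  qed
  then show False using outside by auto
qed

lemma C2_curve_local_scale:
  assumes "C2_curve c" "0 < \<epsilon>"
  obtains \<delta> M where "0 < \<delta>" "0 < M" "\<And>x. x \<in> ball x0 \<delta> \<Longrightarrow> dist (c x0) (c x) < \<epsilon>"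
    "\<And>x. x \<in> ball x0 \<delta> \<Longrightarrow> speed c x \<le> M" "M * (2 * \<delta>) \<le> \<epsilon>"
proof -
  have "bounded (speed c ` cball x0 1)"
    by (intro compact_imp_bounded compact_continuous_image continuous_on_speed assms(1)) simp
  then obtain M where M: "0 < M" "\<forall>r\<in>speed c ` cball x0 1. norm r \<le> M"
    unfolding bounded_pos by blast
  have "open (c -` ball (c x0) \<epsilon>)" by (intro open_vimage open_ball continuous_on_C2_curve assms(1))
  moreover have "x0 \<in> c -` ball (c x0) \<epsilon>" using assms(2) by simp
  ultimately obtain d where d: "0 < d" "ball x0 d \<subseteq> c -` ball (c x0) \<epsilon>"
    using open_contains_ball by blast
  define \<delta> where "\<delta> = min 1 (min d (\<epsilon> / (2 * M)))"
  show ?thesis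
  proof (rule that)
    show "0 < \<delta>" using d(1) M(1) assms(2) unfolding \<delta>_def by simp
    show "dist (c x0) (c x) < \<epsilon>" if "x \<in> ball x0 \<delta>" for x
    proof -
      have "x \<in> ball x0 d" using that unfolding \<delta>_def by simp
      then show ?thesis using d(2) by auto
    qed
    show "speed c x \<le> M" if "x \<in> ball x0 \<delta>" for x
      using that M(2) unfolding \<delta>_def by (simp add: abs_le_iff)
    have "\<delta> \<le> \<epsilon> / (2 * M)" unfolding \<delta>_def by simp
    then show "M * (2 * \<delta>) \<le> \<epsilon>" using M(1) by (simp add: field_simps)
  qed (rule M(1))
qed

lemma shortest_curve_near_arc:
  assumes "C2_curve c" "0 < \<epsilon>"
  obtains \<delta> where "0 < \<delta>" "c ` ball x0 \<delta> \<subseteq> ball (c x0) \<epsilon>"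
    "\<And>X A B \<gamma> s t x y. \<lbrakk>shortest_curve X A B \<gamma>; 0 \<le> s; s \<le> t; t \<le> 1; x \<in> ball x0 \<delta>; y \<in> ball x0 \<delta>;
      \<gamma> s = c x; \<gamma> t = c y; c ` closed_segment x y \<subseteq> X\<rbrakk> \<Longrightarrow> \<gamma> ` {s..t} \<subseteq> ball (c x0) \<epsilon>"
proof -
  obtain \<delta> M where \<delta>: "0 < \<delta>" "0 < M" "\<And>x. x \<in> ball x0 \<delta> \<Longrightarrow> dist (c x0) (c x) < \<epsilon> / 2"
    "\<And>x. x \<in> ball x0 \<delta> \<Longrightarrow> speed c x \<le> M" "M * (2 * \<delta>) \<le> \<epsilon> / 2"
    using C2_curve_local_scale[OF assms(1), of "\<epsilon> / 2"] assms(2) by (metis half_gt_zero)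
  show ?thesis
  proof (rule that[OF \<delta>(1)])
    show "c ` ball x0 \<delta> \<subseteq> ball (c x0) \<epsilon>" using \<delta>(3) assms(2) by force
  next
    fix X A B \<gamma> s t x y
    assume sc: "shortest_curve X A B \<gamma>" and st: "0 \<le> s" "s \<le> t" "t \<le> 1"
      and xy: "x \<in> ball x0 \<delta>" "y \<in> ball x0 \<delta>"
      and ends: "\<gamma> s = c x" "\<gamma> t = c y" and X: "c ` closed_segment x y \<subseteq> X"
    have "closed_segment x y \<subseteq> ball x0 \<delta>" by (intro closed_segment_subset xy convex_ball)
    then have "arc_length \<gamma> s t \<le> M * \<bar>y - x\<bar>"
      by (intro shortest_curve_arc_length_le_C2_curve[OF sc st assms(1) ends X] \<delta>(4)) auto
    also have "\<dots> \<le> M * (2 * \<delta>)"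
      using xy \<delta>(2) by (intro mult_left_mono) (auto simp: dist_real_def)
    also note \<delta>(5)
    finally have short: "arc_length \<gamma> s t \<le> \<epsilon> / 2" .
    have "dist (c x0) (\<gamma> q) < \<epsilon>" if "q \<in> {s..t}" for q
    proof -
      have "dist (\<gamma> s) (\<gamma> q) + dist (\<gamma> q) (\<gamma> t) \<le> arc_length \<gamma> s t"
        using that st by (intro shortest_curve_dist_le[OF sc]) auto
      then have "dist (\<gamma> s) (\<gamma> q) \<le> \<epsilon> / 2" using short zero_le_dist[of "\<gamma> q" "\<gamma> t"] by linarith
      moreover have "dist (c x0) (\<gamma> s) < \<epsilon> / 2" unfolding ends(1) by (rule \<delta>(3)[OF xy(1)])
      ultimately show ?thesis using dist_triangle[of "c x0" "\<gamma> q" "\<gamma> s"] by linarith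
    qed
    then show "\<gamma> ` {s..t} \<subseteq> ball (c x0) \<epsilon>" by auto
  qed
qed

definition visit_times :: "(real \<Rightarrow> 'a) \<Rightarrow> 'a set \<Rightarrow> real set" where
  "visit_times \<gamma> e = {t\<in>{0..1}. \<gamma> t \<in> e}"

lemma connected_visit_timesI:
  assumes "\<And>s r t. \<lbrakk>0 \<le> s; s \<le> r; r \<le> t; t \<le> 1; \<gamma> s \<in> e; \<gamma> t \<in> e\<rbrakk> \<Longrightarrow> \<gamma> r \<in> e"
  shows "connected (visit_times \<gamma> e)"
  unfolding connected_iff_interval visit_times_def using assms by auto

lemma interacts_finitely_iff: "interacts_finitely \<gamma> e \<longleftrightarrow> finite (components (visit_times \<gamma> e))"
  unfolding interacts_finitely_def visit_times_def ..

lemma interacts_finitely_if_connected: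
  assumes "connected (visit_times \<gamma> e)"
  shows "interacts_finitely \<gamma> e"
proof (cases "visit_times \<gamma> e = {}")
  case True
  then show ?thesis unfolding interacts_finitely_iff by simp
next
  case False
  then have "components (visit_times \<gamma> e) = {visit_times \<gamma> e}"
    using assms by (simp add: components_eq_sing_iff)
  then show ?thesis unfolding interacts_finitely_iff by simp
qed

lemma shortest_curve_visits_convex_connected:
  assumes "shortest_curve X A B \<gamma>" "convex e" "e \<subseteq> X"
  shows "connected (visit_times \<gamma> e)"
proof (rule connected_visit_timesI)
  fix s r t assume "0 \<le> s" "s \<le> r" "r \<le> t" "t \<le> 1" and ends: "\<gamma> s \<in> e" "\<gamma> t \<in> e"
  moreover have "closed_segment (\<gamma> s) (\<gamma> t) \<subseteq> e" by (rule closed_segment_subset[OF ends assms(2)])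
  ultimately show "\<gamma> r \<in> e" using shortest_curve_chord[OF assms(1)] assms(3) by blast
qed

lemma finite_components_Union:
  assumes "finite \<C>" "\<And>C. C \<in> \<C> \<Longrightarrow> connected C"
  shows "finite (components (\<Union>\<C>))"
proof -
  let ?component_of = "\<lambda>C. connected_component_set (\<Union>\<C>) (SOME x. x \<in> C)"
  have "components (\<Union>\<C>) \<subseteq> ?component_of ` \<C>"
  proof
    fix K assume "K \<in> components (\<Union>\<C>)"
    then obtain x C where x: "K = connected_component_set (\<Union>\<C>) x" "x \<in> C" "C \<in> \<C>"
      by (auto elim: componentsE)
    have "C \<subseteq> connected_component_set (\<Union>\<C>) x"
      using x assms(2) by (intro connected_component_maximal) auto
    moreover have "(SOME x. x \<in> C) \<in> C" using x(2) by (rule someI)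
    ultimately have "K = ?component_of C"
      unfolding x(1) by (intro connected_component_eq[symmetric]) blast
    then show "K \<in> ?component_of ` \<C>" using x(3) by blast
  qed
  then show ?thesis using assms(1) by (rule finite_surj[rotated])
qed

lemma finite_image_if_middle_repeats:
  fixes f :: "'a::linorder \<Rightarrow> 'b"
  assumes middle: "\<And>s r t. \<lbrakk>s \<in> T; r \<in> T; t \<in> T; s \<le> r; r \<le> t\<rbrakk> \<Longrightarrow> f r = f s \<or> f r = f t"
  shows "finite (f ` T)"
proof (cases "\<exists>s\<in>T. \<exists>t\<in>T. s < t \<and> f s \<noteq> f t")
  case True
  then obtain s t where st: "s \<in> T" "t \<in> T" "s < t" "f s \<noteq> f t" by blast
  have "f r \<in> {f s, f t}" if r: "r \<in> T" for r
  proof -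
    consider "r \<le> s" | "s \<le> r" "r \<le> t" | "t \<le> r" by fastforce
    then show ?thesis
    proof cases
      assume "r \<le> s"
      then show ?thesis using middle[OF r st(1,2)] st(3,4) by auto
    next
      assume "s \<le> r" "r \<le> t"
      then show ?thesis using middle[OF st(1) r st(2)] by auto
    next
      assume "t \<le> r"
      then show ?thesis using middle[OF st(1,2) r] st(3,4) by auto
    qed
  qed
  then have "f ` T \<subseteq> {f s, f t}" by (rule image_subsetI)
  then show ?thesis by (rule finite_subset) simp
next
  case False
  then have same: "f s = f t" if "s \<in> T" "t \<in> T" for s t
    using that by (metis linorder_neqE)
  show ?thesis
  proof (cases "T = {}")
    case False
    then obtain t where "t \<in> T" by blast
    then have "f ` T \<subseteq> {f t}" using same by blast
    then show ?thesis by (rule finite_subset) simp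
  qed simp
qed

lemma shortest_curve_interacts_finitely_if_strict_chords:
  assumes sc: "shortest_curve X A B \<gamma>" and "e \<subseteq> X"
    and chords: "\<And>P Q. \<lbrakk>P \<in> e; Q \<in> e\<rbrakk> \<Longrightarrow> open_segment P Q \<subseteq> X - e"
  shows "interacts_finitely \<gamma> e"
proof -
  let ?T = "visit_times \<gamma> e"
  have middle: "\<gamma> r = \<gamma> s \<or> \<gamma> r = \<gamma> t" if "s \<in> ?T" "r \<in> ?T" "t \<in> ?T" "s \<le> r" "r \<le> t" for s r t
  proof -
    have on: "\<gamma> s \<in> e" "\<gamma> r \<in> e" "\<gamma> t \<in> e" and st: "0 \<le> s" "t \<le> 1"
      using that unfolding visit_times_def by auto
    have "closed_segment (\<gamma> s) (\<gamma> t) \<subseteq> X"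
      using chords[OF on(1,3)] on assms(2) by (auto simp: closed_segment_eq_open)
    then have "\<gamma> r \<in> closed_segment (\<gamma> s) (\<gamma> t)"
      by (rule shortest_curve_chord[OF sc st(1) that(4,5) st(2)])
    then show ?thesis using chords[OF on(1,3)] on(2) by (auto simp: closed_segment_eq_open)
  qed
  have "finite (\<gamma> ` ?T)" using middle by (rule finite_image_if_middle_repeats)
  moreover have "connected (visit_times \<gamma> {z})" if "z \<in> \<gamma> ` ?T" for z
    using that assms(2)
    by (intro shortest_curve_visits_convex_connected[OF sc]) (auto simp: visit_times_def)
  ultimately have "finite (components (\<Union>((\<lambda>z. visit_times \<gamma> {z}) ` \<gamma> ` ?T)))"
    by (intro finite_components_Union) auto
  moreover have "(\<Union>((\<lambda>z. visit_times \<gamma> {z}) ` \<gamma> ` ?T)) = ?T"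
    unfolding visit_times_def by auto
  ultimately show ?thesis unfolding interacts_finitely_iff by simp
qed

section \<open>Strictly quasiconcave barriers\<close>

definition strictly_quasiconcave_on :: "'a::real_vector set \<Rightarrow> ('a \<Rightarrow> real) \<Rightarrow> bool" where
  "strictly_quasiconcave_on U h \<longleftrightarrow>
     convex U \<and> (\<forall>P\<in>U. \<forall>Q\<in>U. \<forall>z\<in>open_segment P Q. min (h P) (h Q) < h z)"

definition contained_or_disjoint :: "'a set \<Rightarrow> 'a set \<Rightarrow> bool" where
  "contained_or_disjoint S X \<longleftrightarrow> S \<subseteq> X \<or> S \<inter> X = {}"

lemma connected_meets_punctured_ball:
  fixes f :: "'a::topological_space \<Rightarrow> 'b::metric_space"
  assumes "connected S" "continuous_on S f" "x \<in> S" "y \<in> S" "f x \<noteq> f y" "0 < \<epsilon>"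
  obtains w where "w \<in> S" "f w \<in> ball (f y) \<epsilon>" "f w \<noteq> f y"
proof -
  let ?d = "\<lambda>w. dist (f w) (f y)"
  have "connected (?d ` S)"
    by (intro connected_continuous_image continuous_intros assms(1,2))
  moreover have "?d y \<in> ?d ` S" "?d x \<in> ?d ` S" using assms(3,4) by auto
  ultimately have "{?d y..?d x} \<subseteq> ?d ` S" by (rule connected_contains_Icc)
  moreover have "min (?d x) (\<epsilon> / 2) \<in> {?d y..?d x}" using assms(6) by simp
  ultimately have "min (?d x) (\<epsilon> / 2) \<in> ?d ` S" by (rule subsetD)
  then obtain w where w: "min (?d x) (\<epsilon> / 2) = ?d w" "w \<in> S" by (rule imageE)
  moreover have "0 < min (?d x) (\<epsilon> / 2)" "min (?d x) (\<epsilon> / 2) < \<epsilon>" using assms(5,6) by auto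
  ultimately show ?thesis using that[of w] by (simp add: dist_commute)
qed

text \<open>Around a lowest point with \<open>h < 0\<close> the curve would be straight, but strict quasiconcavity
  forbids interior minima of \<open>h\<close> on segments.\<close>

lemma shortest_curve_barrier_nonneg:
  assumes sc: "shortest_curve X A B \<gamma>" and st: "0 \<le> s" "t \<le> 1" and r: "r \<in> {s..t}"
    and h: "continuous_on U h" "strictly_quasiconcave_on U h"
    and U: "open U" "\<gamma> ` {s..t} \<subseteq> U" "{z \<in> U. h z < 0} \<subseteq> X"
    and ends: "0 \<le> h (\<gamma> s)" "0 \<le> h (\<gamma> t)"
  shows "0 \<le> h (\<gamma> r)"
proof (rule ccontr)
  assume neg: "\<not> 0 \<le> h (\<gamma> r)"
  have cont: "continuous_on {a..b} \<gamma>" if "s \<le> a" "b \<le> t" for a b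
    using shortest_curveD(3)[OF sc] that st by simp
  have "continuous_on {s..t} (\<lambda>q. h (\<gamma> q))"
    using continuous_on_compose2[OF h(1) cont] U(2) by simp
  then obtain q where q: "q \<in> {s..t}" "\<And>q'. q' \<in> {s..t} \<Longrightarrow> h (\<gamma> q) \<le> h (\<gamma> q')"
    using continuous_attains_inf[OF compact_Icc] r by (metis empty_iff)
  have "h (\<gamma> q) < 0" using q(2)[OF r] neg by simp
  then have off_ends: "\<gamma> s \<noteq> \<gamma> q" "\<gamma> t \<noteq> \<gamma> q" using ends by auto
  have "open (h -` {..<0} \<inter> U)" using h(1) U(1) by (simp add: continuous_on_open_vimage)
  moreover have "\<gamma> q \<in> h -` {..<0} \<inter> U" using \<open>h (\<gamma> q) < 0\<close> U(2) q(1) by auto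
  ultimately obtain \<epsilon> where \<epsilon>: "0 < \<epsilon>" "ball (\<gamma> q) \<epsilon> \<subseteq> h -` {..<0} \<inter> U"
    using open_contains_ball by blast
  obtain a where a: "a \<in> {s..q}" "\<gamma> a \<in> ball (\<gamma> q) \<epsilon>" "\<gamma> a \<noteq> \<gamma> q"
    using connected_meets_punctured_ball[OF connected_Icc cont _ _ off_ends(1) \<epsilon>(1)] q(1) by auto
  obtain b where b: "b \<in> {q..t}" "\<gamma> b \<in> ball (\<gamma> q) \<epsilon>" "\<gamma> b \<noteq> \<gamma> q"
    using connected_meets_punctured_ball[OF connected_Icc cont _ _ off_ends(2) \<epsilon>(1)] q(1) by auto
  have "closed_segment (\<gamma> a) (\<gamma> b) \<subseteq> ball (\<gamma> q) \<epsilon>"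
    by (rule closed_segment_subset[OF a(2) b(2) convex_ball])
  then have "closed_segment (\<gamma> a) (\<gamma> b) \<subseteq> X" using \<epsilon>(2) U(3) by blast
  then have "\<gamma> q \<in> closed_segment (\<gamma> a) (\<gamma> b)"
    using a(1) b(1) st by (intro shortest_curve_chord[OF sc]) auto
  then have "\<gamma> q \<in> open_segment (\<gamma> a) (\<gamma> b)" using a(3) b(3) by (simp add: open_segment_def)
  moreover have "\<gamma> a \<in> U" "\<gamma> b \<in> U" using a(2) b(2) \<epsilon>(2) by auto
  ultimately have "min (h (\<gamma> a)) (h (\<gamma> b)) < h (\<gamma> q)"
    using h(2) unfolding strictly_quasiconcave_on_def by blast
  moreover have "h (\<gamma> q) \<le> h (\<gamma> a)" "h (\<gamma> q) \<le> h (\<gamma> b)" using q a(1) b(1) by simp_all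
  ultimately show False by simp
qed

locale level_curve =
  fixes c :: "real \<Rightarrow> real \<times> real" and f h :: "real \<times> real \<Rightarrow> real" and U :: "(real \<times> real) set"
  assumes C2: "C2_curve c"
    and coordinate: "continuous_on UNIV f" "f (c x) = x"
    and barrier: "open U" "continuous_on U h" "strictly_quasiconcave_on U h"
    and level_zero: "h (c x) = 0"
    and level_range: "z \<in> U \<Longrightarrow> h z = 0 \<Longrightarrow> c (f z) = z"
begin

lemma interacts_finitely_if_convex_side:
  assumes "shortest_curve X A B \<gamma>" "c ` I \<subseteq> X \<inter> U" "{z \<in> U. 0 < h z} \<subseteq> X"
  shows "interacts_finitely \<gamma> (c ` I)"
proof (rule shortest_curve_interacts_finitely_if_strict_chords[OF assms(1)])
  show "c ` I \<subseteq> X" using assms(2) by simp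
  fix P Q assume PQ: "P \<in> c ` I" "Q \<in> c ` I"
  then have "P \<in> U" "Q \<in> U" using assms(2) by auto
  show "open_segment P Q \<subseteq> X - c ` I"
  proof
    fix z assume z: "z \<in> open_segment P Q"
    have "min (h P) (h Q) < h z"
      using barrier(3) z \<open>P \<in> U\<close> \<open>Q \<in> U\<close> unfolding strictly_quasiconcave_on_def by blast
    then have "0 < h z" using PQ level_zero by auto
    moreover have "z \<in> U"
      using barrier(3) closed_segment_subset[OF \<open>P \<in> U\<close> \<open>Q \<in> U\<close>] open_closed_segment[OF z]
      unfolding strictly_quasiconcave_on_def by blast
    ultimately show "z \<in> X - c ` I" using assms(3) level_zero by force
  qed
qed

lemma shortest_curve_stays_on_level:
  assumes "shortest_curve X A B \<gamma>" "0 \<le> s" "t \<le> 1" "\<gamma> ` {s..t} \<subseteq> U"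
    and above: "{z \<in> U. 0 < h z} \<inter> X = {}"
    and below: "contained_or_disjoint {z \<in> U. h z < 0} X"
    and "h (\<gamma> s) = 0" "h (\<gamma> t) = 0" "r \<in> {s..t}"
  shows "h (\<gamma> r) = 0"
proof (rule antisym)
  have r: "\<gamma> r \<in> U" "\<gamma> r \<in> X"
    using assms(2-4,9) shortest_curveD(2)[OF assms(1)] by auto
  then show "h (\<gamma> r) \<le> 0" using above by force
  show "0 \<le> h (\<gamma> r)"
  proof (cases "{z \<in> U. h z < 0} \<subseteq> X")
    case True
    then show ?thesis
      using assms by (intro shortest_curve_barrier_nonneg[OF assms(1-3,9) barrier(2,3,1)]) auto
  next
    case False
    then have "{z \<in> U. h z < 0} \<inter> X = {}" using below unfolding contained_or_disjoint_def by blast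
    then show ?thesis using r by force
  qed
qed

lemma shortest_curve_stays_on_arc:
  assumes sc: "shortest_curve X A B \<gamma>" and st: "0 \<le> s" "s \<le> r" "r \<le> t" "t \<le> 1"
    and I: "convex I" "\<gamma> s \<in> c ` I" "\<gamma> t \<in> c ` I" and U: "\<gamma> ` {s..t} \<subseteq> U"
    and above: "{z \<in> U. 0 < h z} \<inter> X = {}"
    and below: "contained_or_disjoint {z \<in> U. h z < 0} X"
  shows "\<gamma> r \<in> c ` I"
proof -
  obtain x y where xy: "x \<in> I" "\<gamma> s = c x" "y \<in> I" "\<gamma> t = c y" using I(2,3) by blast
  have on_range: "c (f (\<gamma> q)) = \<gamma> q" if "q \<in> {s..t}" for q
  proof (rule level_range)
    show "\<gamma> q \<in> U" using that by (intro subsetD[OF U] imageI)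
    show "h (\<gamma> q) = 0"
      by (rule shortest_curve_stays_on_level[OF sc st(1,4) U above below _ _ that])
         (simp_all add: xy(2,4) level_zero)
  qed
  have "inj_on f (\<gamma> ` {s..t})"
    by (rule inj_on_inverseI[where g = c]) (use on_range in blast)
  moreover have "continuous_on (\<gamma> ` {s..t}) f"
    using coordinate(1) by (rule continuous_on_subset) simp
  ultimately have "f (\<gamma> r) \<in> closed_segment (f (\<gamma> s)) (f (\<gamma> t))"
    by (intro shortest_curve_between[OF sc st])
  moreover have "closed_segment x y \<subseteq> I" by (rule closed_segment_subset[OF xy(1,3) I(1)])
  ultimately have "f (\<gamma> r) \<in> I" unfolding xy(2,4) coordinate(2) by blast
  then have "c (f (\<gamma> r)) \<in> c ` I" by (rule imageI)
  then show ?thesis using on_range[of r] st by simp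
qed

lemma short_arcs_interact_finitely:
  assumes "c x0 \<in> U"
    and "contained_or_disjoint {z \<in> U. 0 < h z} X" "contained_or_disjoint {z \<in> U. h z < 0} X"
  obtains \<delta> where "0 < \<delta>"
    "\<And>I A B \<gamma>. \<lbrakk>convex I; I \<subseteq> ball x0 \<delta>; c ` I \<subseteq> X; shortest_curve X A B \<gamma>\<rbrakk>
      \<Longrightarrow> interacts_finitely \<gamma> (c ` I)"
proof -
  obtain \<epsilon> where \<epsilon>: "0 < \<epsilon>" "ball (c x0) \<epsilon> \<subseteq> U"
    using assms(1) barrier(1) open_contains_ball by blast
  obtain \<delta> where \<delta>: "0 < \<delta>" "c ` ball x0 \<delta> \<subseteq> ball (c x0) \<epsilon>"
    and near: "\<And>A B \<gamma> s t x y. \<lbrakk>shortest_curve X A B \<gamma>; 0 \<le> s; s \<le> t; t \<le> 1;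
      x \<in> ball x0 \<delta>; y \<in> ball x0 \<delta>; \<gamma> s = c x; \<gamma> t = c y; c ` closed_segment x y \<subseteq> X\<rbrakk>
      \<Longrightarrow> \<gamma> ` {s..t} \<subseteq> ball (c x0) \<epsilon>"
    using shortest_curve_near_arc[OF C2 \<epsilon>(1)] by metis
  show thesis
  proof (rule that[OF \<delta>(1)])
    fix I A B \<gamma>
    assume I: "convex I" "I \<subseteq> ball x0 \<delta>" "c ` I \<subseteq> X" and sc: "shortest_curve X A B \<gamma>"
    consider "{z \<in> U. 0 < h z} \<subseteq> X" | "{z \<in> U. 0 < h z} \<inter> X = {}"
      using assms(2) unfolding contained_or_disjoint_def by blast
    then show "interacts_finitely \<gamma> (c ` I)"
    proof cases
      assume convex_side: "{z \<in> U. 0 < h z} \<subseteq> X"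
      have "c ` I \<subseteq> X \<inter> U" using I(2,3) \<delta>(2) \<epsilon>(2) by blast
      then show ?thesis by (rule interacts_finitely_if_convex_side[OF sc _ convex_side])
    next
      assume above: "{z \<in> U. 0 < h z} \<inter> X = {}"
      show ?thesis
      proof (rule interacts_finitely_if_connected[OF connected_visit_timesI])
        fix s r t assume st: "0 \<le> s" "s \<le> r" "r \<le> t" "t \<le> 1" and on: "\<gamma> s \<in> c ` I" "\<gamma> t \<in> c ` I"
        then obtain x y where xy: "x \<in> I" "\<gamma> s = c x" "y \<in> I" "\<gamma> t = c y" by blast
        then have "closed_segment x y \<subseteq> I" using I(1) by (intro closed_segment_subset)
        then have "\<gamma> ` {s..t} \<subseteq> ball (c x0) \<epsilon>" using xy I(2,3) st by (intro near[OF sc]) auto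
        then have "\<gamma> ` {s..t} \<subseteq> U" using \<epsilon>(2) by simp
        then show "\<gamma> r \<in> c ` I"
          by (rule shortest_curve_stays_on_arc[OF sc st I(1) on _ above assms(3)])
      qed
    qed
  qed
qed

end

section \<open>Countable decompositions\<close>

definition decomposable :: "('a set \<Rightarrow> bool) \<Rightarrow> 'a set \<Rightarrow> bool" where
  "decomposable P S \<longleftrightarrow> (\<exists>\<C>. countable \<C> \<and> disjoint \<C> \<and> \<Union>\<C> = S \<and> (\<forall>e\<in>\<C>. P e))"

lemma decomposable_single: "P e \<Longrightarrow> decomposable P e"
  unfolding decomposable_def by (intro exI[of _ "{e}"]) auto

lemma decomposable_mono:
  assumes "decomposable P S" "\<And>e. e \<subseteq> S \<Longrightarrow> P e \<Longrightarrow> Q e"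
  shows "decomposable Q S"
  using assms unfolding decomposable_def by (metis Union_upper)

lemma decomposable_Union:
  assumes "countable \<S>" "disjoint \<S>" "\<And>S. S \<in> \<S> \<Longrightarrow> decomposable P S"
  shows "decomposable P (\<Union>\<S>)"
proof -
  have "\<forall>S\<in>\<S>. \<exists>\<C>. countable \<C> \<and> disjoint \<C> \<and> \<Union>\<C> = S \<and> (\<forall>e\<in>\<C>. P e)"
    using assms(3) unfolding decomposable_def by blast
  then obtain \<C> where \<C>: "\<And>S. S \<in> \<S> \<Longrightarrow> countable (\<C> S)" "\<And>S. S \<in> \<S> \<Longrightarrow> disjoint (\<C> S)"
      "\<And>S. S \<in> \<S> \<Longrightarrow> \<Union>(\<C> S) = S" "\<And>S e. S \<in> \<S> \<Longrightarrow> e \<in> \<C> S \<Longrightarrow> P e"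
    by metis
  have "disjoint_family_on (\<lambda>S. \<Union>(\<C> S)) \<S>"
    using assms(2) unfolding disjoint_family_on_def by (simp add: \<C>(3) disjointD)
  then have "disjoint (\<Union>S\<in>\<S>. \<C> S)" by (intro disjoint_UN \<C>(2))
  moreover have "countable (\<Union>S\<in>\<S>. \<C> S)" using assms(1) \<C>(1) by simp
  moreover have "\<Union>(\<Union>S\<in>\<S>. \<C> S) = (\<Union>S\<in>\<S>. \<Union>(\<C> S))" by blast
  then have "\<Union>(\<Union>S\<in>\<S>. \<C> S) = \<Union>\<S>" by (simp add: \<C>(3))
  moreover have "\<forall>e\<in>(\<Union>S\<in>\<S>. \<C> S). P e" using \<C>(4) by blast
  ultimately show ?thesis unfolding decomposable_def by blast
qed

lemma decomposable_Un:
  assumes "decomposable P S" "decomposable P T" "S \<inter> T = {}"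
  shows "decomposable P (S \<union> T)"
proof -
  have "decomposable P (\<Union>{S, T})"
    by (rule decomposable_Union) (use assms in \<open>auto simp: disjoint_def\<close>)
  then show ?thesis by simp
qed

lemma decomposable_countable:
  assumes "countable S" "\<And>x. x \<in> S \<Longrightarrow> P {x}"
  shows "decomposable P S"
proof -
  have "decomposable P (\<Union>((\<lambda>x. {x}) ` S))"
    by (rule decomposable_Union) (use assms in \<open>auto simp: disjoint_def intro: decomposable_single\<close>)
  then show ?thesis by simp
qed

lemma decomposable_image:
  assumes "decomposable (\<lambda>e. P (f ` e)) S" "inj f"
  shows "decomposable P (f ` S)"
proof -
  obtain \<C> where \<C>: "countable \<C>" "disjoint \<C>" "\<Union>\<C> = S" "\<forall>e\<in>\<C>. P (f ` e)"
    using assms(1) unfolding decomposable_def by blast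
  have "disjoint ((`) f ` \<C>)"
    using \<C>(2) assms(2) unfolding disjoint_def by (auto simp: image_Int[symmetric])
  moreover have "\<Union>((`) f ` \<C>) = f ` S" using \<C>(3) by auto
  ultimately show ?thesis
    unfolding decomposable_def using \<C>(1,4) by (intro exI[of _ "(`) f ` \<C>"]) auto
qed

lemma decomposable_Times:
  assumes "decomposable P S" "decomposable Q T" "\<And>I J. P I \<Longrightarrow> Q J \<Longrightarrow> R (I \<times> J)"
  shows "decomposable R (S \<times> T)"
proof -
  obtain \<C> where \<C>: "countable \<C>" "disjoint \<C>" "\<Union>\<C> = S" "\<forall>I\<in>\<C>. P I"
    using assms(1) unfolding decomposable_def by blast
  obtain \<D> where \<D>: "countable \<D>" "disjoint \<D>" "\<Union>\<D> = T" "\<forall>J\<in>\<D>. Q J"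
    using assms(2) unfolding decomposable_def by blast
  let ?\<E> = "(\<lambda>p. fst p \<times> snd p) ` (\<C> \<times> \<D>)"
  have "disjoint ?\<E>"
  proof (rule disjointI)
    fix A B assume "A \<in> ?\<E>" "B \<in> ?\<E>" "A \<noteq> B"
    then obtain p q where pq: "p \<in> \<C> \<times> \<D>" "q \<in> \<C> \<times> \<D>"
      and AB: "A = fst p \<times> snd p" "B = fst q \<times> snd q"
      by (elim imageE) simp
    have "fst p \<noteq> fst q \<or> snd p \<noteq> snd q" using \<open>A \<noteq> B\<close> unfolding AB by auto
    then have "fst p \<inter> fst q = {} \<or> snd p \<inter> snd q = {}"
      using pq disjointD[OF \<C>(2)] disjointD[OF \<D>(2)] unfolding mem_Times_iff by metis
    then show "A \<inter> B = {}" unfolding AB by auto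
  qed
  moreover have "countable ?\<E>" using \<C>(1) \<D>(1) by simp
  moreover have "\<Union>?\<E> = S \<times> T" using \<C>(3) \<D>(3) by auto
  moreover have "\<forall>e\<in>?\<E>. R e" using \<C>(4) \<D>(4) assms(3) by auto
  ultimately show ?thesis unfolding decomposable_def by blast
qed

definition refining_partitions :: "(nat \<Rightarrow> 'a \<Rightarrow> 'a set) \<Rightarrow> bool" where
  "refining_partitions D \<longleftrightarrow> (\<forall>n z. z \<in> D n z) \<and> (\<forall>n y z. y \<in> D n z \<longrightarrow> D n y = D n z)
     \<and> (\<forall>n z. D (Suc n) z \<subseteq> D n z) \<and> (\<forall>n. countable (range (D n)))"

lemma refining_partitionsD:
  assumes "refining_partitions D"
  shows "z \<in> D n z" and "y \<in> D n z \<Longrightarrow> D n y = D n z"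
    and "D (Suc n) z \<subseteq> D n z" and "countable (range (D n))"
  using assms unfolding refining_partitions_def by auto

lemma refining_partitions_coarser_eq:
  assumes "refining_partitions D" "y \<in> D n z" "m \<le> n"
  shows "D m y = D m z"
proof -
  have "D n z \<subseteq> D m z"
    by (rule lift_Suc_antimono_le[of "\<lambda>n. D n z", OF refining_partitionsD(3)[OF assms(1)] assms(3)])
  then show ?thesis using assms(2) by (intro refining_partitionsD(2)[OF assms(1)]) blast
qed

lemma refining_partitions_Times:
  assumes "refining_partitions D" "refining_partitions E"
  shows "refining_partitions (\<lambda>n z. D n (fst z) \<times> E n (snd z))"
proof -
  have "countable (range (\<lambda>z. D n (fst z) \<times> E n (snd z)))" for n
  proof (rule countable_subset)
    show "range (\<lambda>z. D n (fst z) \<times> E n (snd z)) \<subseteq> (\<lambda>(S, T). S \<times> T) ` (range (D n) \<times> range (E n))"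
      by auto
    show "countable ((\<lambda>(S, T). S \<times> T) ` (range (D n) \<times> range (E n)))"
      by (simp add: refining_partitionsD(4) assms)
  qed
  moreover have "D (Suc n) x \<times> E (Suc n) y \<subseteq> D n x \<times> E n y" for n x y
    by (intro Sigma_mono refining_partitionsD(3) assms)
  moreover have "D n (fst y) \<times> E n (snd y) = D n (fst z) \<times> E n (snd z)"
    if "y \<in> D n (fst z) \<times> E n (snd z)" for n y z
    using that refining_partitionsD(2)[OF assms(1), of "fst y" n "fst z"]
      refining_partitionsD(2)[OF assms(2), of "snd y" n "snd z"] by (simp add: mem_Times_iff)
  ultimately show ?thesis
    unfolding refining_partitions_def by (simp add: mem_Times_iff refining_partitionsD(1) assms)
qed

text \<open>Each point picks the first cell of its nested chain that satisfies the property; two such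
  cells that meet are equal.\<close>

lemma decomposable_refining_partitions:
  assumes D: "refining_partitions D"
    and locally: "\<And>z. z \<in> G \<Longrightarrow> \<exists>n. D n z \<subseteq> G \<and> decomposable P (D n z)"
  shows "decomposable P G"
proof -
  define good where "good S \<longleftrightarrow> S \<subseteq> G \<and> decomposable P S" for S
  define first where "first n z \<longleftrightarrow> good (D n z) \<and> (\<forall>m<n. \<not> good (D m z))" for n z
  define \<S> where "\<S> = {D n z | n z. first n z}"
  have first_cong: "first n z" if "first n y" "z \<in> D n y" for n y z
    using that(1) refining_partitions_coarser_eq[OF D that(2)] unfolding first_def by simp
  have first_unique: "m = n" if "first m z" "first n z" for m n z
    using that unfolding first_def by (metis linorder_neqE_nat)
  have "\<S> \<subseteq> (\<Union>n. range (D n))" unfolding \<S>_def by auto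
  then have "countable \<S>" by (rule countable_subset) (simp add: refining_partitionsD(4)[OF D])
  moreover have "disjoint \<S>"
  proof (rule disjointI, rule ccontr)
    fix S T assume ST: "S \<in> \<S>" "T \<in> \<S>" "S \<noteq> T" "S \<inter> T \<noteq> {}"
    then obtain m n x y z where xyz: "S = D m x" "first m x" "T = D n y" "first n y"
        "z \<in> D m x" "z \<in> D n y"
      unfolding \<S>_def by blast
    then have "m = n" using first_cong first_unique by metis
    then show False using ST(3) xyz refining_partitionsD(2)[OF D] by metis
  qed
  moreover have "decomposable P S" if "S \<in> \<S>" for S
    using that unfolding \<S>_def first_def good_def by auto
  ultimately have "decomposable P (\<Union>\<S>)" by (rule decomposable_Union)
  moreover have "\<Union>\<S> = G"
  proof
    show "\<Union>\<S> \<subseteq> G" unfolding \<S>_def first_def good_def by auto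
    show "G \<subseteq> \<Union>\<S>"
    proof
      fix z assume "z \<in> G"
      then have "\<exists>n. good (D n z)" unfolding good_def by (rule locally)
      then have "\<exists>n. first n z" unfolding first_def by (rule exists_least_iff[THEN iffD1])
      then show "z \<in> \<Union>\<S>" unfolding \<S>_def using refining_partitionsD(1)[OF D] by blast
    qed
  qed
  ultimately show ?thesis by simp
qed

definition dyadic_interval :: "nat \<Rightarrow> real \<Rightarrow> real set" where
  "dyadic_interval n x = {y. \<lfloor>2 ^ n * y\<rfloor> = \<lfloor>2 ^ n * x\<rfloor>}"

lemma refining_partitions_dyadic_interval: "refining_partitions dyadic_interval"
proof -
  have "\<lfloor>2 ^ n * y\<rfloor> = \<lfloor>2 ^ Suc n * y\<rfloor> div 2" for n and y :: real
    using floor_divide_real_eq_div[of 2 "2 ^ Suc n * y"] by simp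
  then have "dyadic_interval (Suc n) x \<subseteq> dyadic_interval n x" for n x
    unfolding dyadic_interval_def by auto
  moreover have "countable (range (dyadic_interval n))" for n
  proof (rule countable_subset)
    show "range (dyadic_interval n) \<subseteq> range (\<lambda>k::int. {y. \<lfloor>2 ^ n * y\<rfloor> = k})"
      unfolding dyadic_interval_def by auto
  qed simp
  ultimately show ?thesis unfolding refining_partitions_def by (simp add: dyadic_interval_def)
qed

lemma dyadic_interval_eq:
  "dyadic_interval n x = {of_int \<lfloor>2 ^ n * x\<rfloor> / 2 ^ n ..< (of_int \<lfloor>2 ^ n * x\<rfloor> + 1) / 2 ^ n}"
  unfolding dyadic_interval_def by (auto simp: floor_eq_iff field_simps)

lemma eventually_dyadic_interval_subset:
  assumes "open T" "x \<in> T"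
  shows "\<forall>\<^sub>F n in sequentially. dyadic_interval n x \<subseteq> T"
proof -
  obtain r where r: "0 < r" "ball x r \<subseteq> T" using assms open_contains_ball by blast
  have "(\<lambda>n. (1 / 2) ^ n) \<longlonglongrightarrow> (0 :: real)" by (rule LIMSEQ_power_zero) simp
  then have "\<forall>\<^sub>F n in sequentially. (1 / 2) ^ n < r" using r(1) by (rule order_tendstoD(2))
  then show ?thesis
  proof (rule eventually_mono)
    fix n assume n: "(1 / 2 :: real) ^ n < r"
    have "y \<in> ball x r" if "y \<in> dyadic_interval n x" for y
    proof -
      have "\<bar>2 ^ n * x - 2 ^ n * y\<bar> < 1"
        using that unfolding dyadic_interval_def by (simp, linarith)
      then have "2 ^ n * \<bar>x - y\<bar> < 1" by (simp flip: right_diff_distrib add: abs_mult)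
      then have "\<bar>x - y\<bar> < (1 / 2) ^ n" by (simp add: field_simps)
      then show ?thesis using n by (simp add: dist_real_def)
    qed
    then show "dyadic_interval n x \<subseteq> T" using r(2) by blast
  qed
qed

definition point_or_open_interval :: "real set \<Rightarrow> bool" where
  "point_or_open_interval I \<longleftrightarrow> (\<exists>a. I = {a}) \<or> (\<exists>a b. a < b \<and> I = {a<..<b})"

lemma decomposable_dyadic_interval: "decomposable point_or_open_interval (dyadic_interval n x)"
proof -
  obtain a b where ab: "dyadic_interval n x = {a..<b}" "a < b"
    using dyadic_interval_eq[of n x] by (auto simp: field_simps)
  have "decomposable point_or_open_interval ({a} \<union> {a<..<b})"
    using ab(2)
    by (intro decomposable_Un decomposable_single) (auto simp: point_or_open_interval_def)
  moreover have "{a} \<union> {a<..<b} = {a..<b}" using ab(2) by auto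
  ultimately show ?thesis using ab(1) by simp
qed

lemma decomposable_open_real:
  assumes "\<And>T. T \<in> \<T> \<Longrightarrow> open T"
    and "\<And>T I. \<lbrakk>T \<in> \<T>; I \<subseteq> T; point_or_open_interval I\<rbrakk> \<Longrightarrow> P I"
  shows "decomposable P (\<Union>\<T>)"
proof (rule decomposable_refining_partitions[OF refining_partitions_dyadic_interval])
  fix x assume "x \<in> \<Union>\<T>"
  then obtain T where T: "T \<in> \<T>" "x \<in> T" by blast
  obtain n where "dyadic_interval n x \<subseteq> T"
    using eventually_happens[OF eventually_dyadic_interval_subset[OF assms(1)[OF T(1)] T(2)]]
    by auto
  moreover from this have "decomposable P (dyadic_interval n x)"
    using assms(2)[OF T(1)] by (intro decomposable_mono[OF decomposable_dyadic_interval]) auto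
  ultimately show "\<exists>n. dyadic_interval n x \<subseteq> \<Union>\<T> \<and> decomposable P (dyadic_interval n x)"
    using T(1) by blast
qed

lemma decomposable_open_plane:
  assumes "open G"
    and rectangle: "\<And>I J. \<lbrakk>point_or_open_interval I; point_or_open_interval J; I \<times> J \<subseteq> G\<rbrakk>
      \<Longrightarrow> P (I \<times> J)"
  shows "decomposable P G"
proof (rule decomposable_refining_partitions)
  let ?D = "\<lambda>n z. dyadic_interval n (fst z) \<times> dyadic_interval n (snd z)"
  show "refining_partitions ?D"
    by (intro refining_partitions_Times refining_partitions_dyadic_interval)
  fix z assume "z \<in> G"
  then obtain S T where ST: "open S" "open T" "z \<in> S \<times> T" "S \<times> T \<subseteq> G"
    by (rule open_prod_elim[OF assms(1)])
  then have "\<forall>\<^sub>F n in sequentially. dyadic_interval n (fst z) \<subseteq> S \<and> dyadic_interval n (snd z) \<subseteq> T"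
    by (intro eventually_conj eventually_dyadic_interval_subset) auto
  then obtain n where "dyadic_interval n (fst z) \<subseteq> S" "dyadic_interval n (snd z) \<subseteq> T"
    using eventually_happens by fastforce
  then have sub: "?D n z \<subseteq> G" using ST(4) by blast
  have "decomposable (\<lambda>e. e \<subseteq> G \<longrightarrow> P e) (?D n z)"
    by (intro decomposable_Times[OF decomposable_dyadic_interval decomposable_dyadic_interval])
       (use rectangle in blast)
  then have "decomposable P (?D n z)" by (rule decomposable_mono) (use sub in blast)
  then show "\<exists>n. ?D n z \<subseteq> G \<and> decomposable P (?D n z)" using sub by blast
qed

section \<open>Fine cells\<close>

definition fine_cell :: "(real \<times> real) set \<Rightarrow> (real \<times> real) set \<Rightarrow> bool" where
  "fine_cell X e \<longleftrightarrow> is_cell e \<and> e \<subseteq> X \<and>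
     (\<forall>A B \<gamma>. shortest_curve X A B \<gamma> \<longrightarrow> interacts_finitely \<gamma> e)"

lemma convex_point_or_open_interval: "point_or_open_interval I \<Longrightarrow> convex I"
  unfolding point_or_open_interval_def by auto

lemma is_cell_arc:
  assumes "continuous_on UNIV c" "continuous_on UNIV f" "\<And>x. f (c x) = x" "point_or_open_interval I"
  shows "is_cell (c ` I)"
  using assms(4) unfolding point_or_open_interval_def
proof (elim disjE exE conjE)
  fix a b :: real assume ab: "a < b" "I = {a<..<b}"
  have "homeomorphism I (c ` I) c f"
    using assms(1-3) by (intro homeomorphismI) (auto intro: continuous_on_subset)
  then have "c ` I homeomorphic I" unfolding homeomorphic_def using homeomorphism_symD by blast
  also have "I homeomorphic (UNIV :: real set)"
    unfolding ab(2) by (rule homeomorphic_open_interval_UNIV[OF ab(1)])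
  finally show ?thesis unfolding is_cell_def by simp
qed (simp add: is_cell_def)

lemma is_cell_rectangle:
  assumes "point_or_open_interval I" "point_or_open_interval J"
  shows "is_cell (I \<times> J)"
proof -
  consider a where "I = {a}" | b where "J = {b}"
    | a b c d where "I = {a<..<b}" "a < b" "J = {c<..<d}" "c < d"
    using assms unfolding point_or_open_interval_def by blast
  then show ?thesis
  proof cases
    fix a assume "I = {a}"
    then have "I \<times> J = Pair a ` J" by auto
    moreover have "is_cell (Pair a ` J)"
      by (rule is_cell_arc[of _ snd]) (auto intro!: continuous_intros assms)
    ultimately show ?thesis by simp
  next
    fix b assume "J = {b}"
    then have "I \<times> J = (\<lambda>x. (x, b)) ` I" by auto
    moreover have "is_cell ((\<lambda>x. (x, b)) ` I)"
      by (rule is_cell_arc[of _ fst]) (auto intro!: continuous_intros assms)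
    ultimately show ?thesis by simp
  next
    fix a b c d assume open_rectangle: "I = {a<..<b}" "a < b" "J = {c<..<d}" "c < d"
    have box: "box (a, c) (b, d) = I \<times> J"
      unfolding open_rectangle by (auto simp: box_def Basis_prod_def ball_Un)
    have "box (a, c) (b, d) \<noteq> {}" unfolding box using open_rectangle by simp
    then show ?thesis
      using homeomorphic_box_UNIV[of "(a, c)" "(b, d)"] unfolding is_cell_def box by simp
  qed
qed

lemma fine_cell_convex:
  assumes "is_cell e" "convex e" "e \<subseteq> X"
  shows "fine_cell X e"
  unfolding fine_cell_def
  using assms shortest_curve_visits_convex_connected interacts_finitely_if_connected by blast

lemma fine_cell_point: "z \<in> X \<Longrightarrow> fine_cell X {z}"
  by (rule fine_cell_convex) (auto simp: is_cell_def)

lemma decomposable_open_subset: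
  assumes "open G" "G \<subseteq> X"
  shows "decomposable (fine_cell X) G"
  using assms(2)
  by (intro decomposable_open_plane[OF assms(1)] fine_cell_convex is_cell_rectangle convex_Times
      convex_point_or_open_interval) auto

definition fine_parameters :: "(real \<times> real) set \<Rightarrow> (real \<Rightarrow> real \<times> real) \<Rightarrow> real set \<Rightarrow> bool" where
  "fine_parameters X c T \<longleftrightarrow>
     open T \<and> (\<forall>I\<subseteq>T. point_or_open_interval I \<longrightarrow> fine_cell X (c ` I))"

lemma fine_parameters_Int: "fine_parameters X c T \<Longrightarrow> open S \<Longrightarrow> fine_parameters X c (T \<inter> S)"
  unfolding fine_parameters_def by (auto intro: open_Int)

lemma fine_parameters_image_subset:
  assumes "fine_parameters X c T"
  shows "c ` T \<subseteq> X"
proof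
  fix z assume "z \<in> c ` T"
  then obtain x where x: "x \<in> T" "z = c x" by blast
  have "point_or_open_interval {x}" unfolding point_or_open_interval_def by blast
  moreover have "{x} \<subseteq> T" using x(1) by simp
  ultimately have "fine_cell X (c ` {x})" using assms unfolding fine_parameters_def by blast
  then show "z \<in> X" unfolding fine_cell_def x(2) by simp
qed

lemma (in level_curve) ex_fine_parameters:
  assumes "c x0 \<in> U" "{z \<in> U. h z = 0} \<subseteq> X"
    and "contained_or_disjoint {z \<in> U. 0 < h z} X" "contained_or_disjoint {z \<in> U. h z < 0} X"
  shows "\<exists>T. x0 \<in> T \<and> fine_parameters X c T"
proof -
  obtain \<delta> where \<delta>: "0 < \<delta>"
    "\<And>I A B \<gamma>. \<lbrakk>convex I; I \<subseteq> ball x0 \<delta>; c ` I \<subseteq> X; shortest_curve X A B \<gamma>\<rbrakk>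
      \<Longrightarrow> interacts_finitely \<gamma> (c ` I)"
    using short_arcs_interact_finitely[OF assms(1,3,4)] by metis
  let ?T = "ball x0 \<delta> \<inter> c -` U"
  have "open ?T" by (intro open_Int open_ball open_vimage barrier(1) continuous_on_C2_curve C2)
  moreover have "fine_cell X (c ` I)" if I: "I \<subseteq> ?T" "point_or_open_interval I" for I
  proof -
    have "c x \<in> {z \<in> U. h z = 0}" if "x \<in> I" for x using I(1) that level_zero by auto
    then have "c ` I \<subseteq> X" using assms(2) by blast
    moreover have "is_cell (c ` I)"
      by (rule is_cell_arc[OF continuous_on_C2_curve[OF C2] coordinate I(2)])
    moreover have "interacts_finitely \<gamma> (c ` I)" if "shortest_curve X A B \<gamma>" for A B \<gamma>
      using I(1) \<open>c ` I \<subseteq> X\<close>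
      by (intro \<delta>(2)[OF convex_point_or_open_interval[OF I(2)] _ _ that]) simp_all
    ultimately show ?thesis unfolding fine_cell_def by simp
  qed
  ultimately have "fine_parameters X c ?T" unfolding fine_parameters_def by simp
  moreover have "x0 \<in> ?T" using \<delta>(1) assms(1) by simp
  ultimately show ?thesis by (intro exI conjI)
qed

section \<open>Rotated polynomial graphs\<close>

definition abscissa :: "real \<Rightarrow> real \<times> real \<Rightarrow> real" where
  "abscissa \<theta> z = fst z * cos \<theta> + snd z * sin \<theta>"

definition ordinate :: "real \<Rightarrow> real \<times> real \<Rightarrow> real" where
  "ordinate \<theta> z = - fst z * sin \<theta> + snd z * cos \<theta>"

definition graph_point :: "real \<Rightarrow> real poly \<Rightarrow> real \<Rightarrow> real \<times> real" where
  "graph_point \<theta> p x = (x * cos \<theta> - poly p x * sin \<theta>, x * sin \<theta> + poly p x * cos \<theta>)"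

lemma Phi_eq: "Phi p \<theta> z = poly p (abscissa \<theta> z) - ordinate \<theta> z"
  unfolding Phi_def abscissa_def ordinate_def ..

lemma continuous_on_Phi: "continuous_on S (Phi p \<theta>)"
  unfolding Phi_def by (intro continuous_intros)

lemma continuous_on_abscissa: "continuous_on S (abscissa \<theta>)"
  unfolding abscissa_def by (intro continuous_intros)

lemma linear_abscissa: "linear (abscissa \<theta>)"
  by (rule linearI) (simp_all add: abscissa_def algebra_simps)

lemma linear_ordinate: "linear (ordinate \<theta>)"
  by (rule linearI) (simp_all add: ordinate_def algebra_simps)

lemma rotated_coordinates_inject:
  assumes "abscissa \<theta> z = abscissa \<theta> w" "ordinate \<theta> z = ordinate \<theta> w"
  shows "z = w"
proof -
  have "fst z = abscissa \<theta> z * cos \<theta> - ordinate \<theta> z * sin \<theta>"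
    "snd z = abscissa \<theta> z * sin \<theta> + ordinate \<theta> z * cos \<theta>" for z
    unfolding abscissa_def ordinate_def using sin_cos_squared_add[of \<theta>] by algebra+
  then show ?thesis using assms by (metis prod_eqI)
qed

lemma abscissa_graph_point [simp]: "abscissa \<theta> (graph_point \<theta> p x) = x"
  and ordinate_graph_point [simp]: "ordinate \<theta> (graph_point \<theta> p x) = poly p x"
  unfolding abscissa_def ordinate_def graph_point_def fst_conv snd_conv
  using sin_cos_squared_add[of \<theta>] by algebra+

lemma Phi_graph_point [simp]: "Phi p \<theta> (graph_point \<theta> p x) = 0"
  by (simp add: Phi_eq)

lemma graph_point_abscissa: "Phi p \<theta> z = 0 \<Longrightarrow> graph_point \<theta> p (abscissa \<theta> z) = z"
  by (rule rotated_coordinates_inject[of \<theta>]) (simp_all add: Phi_eq)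

lemma range_graph_point: "range (graph_point \<theta> p) = {z. Phi p \<theta> z = 0}"
proof (intro equalityI subsetI)
  fix z assume "z \<in> {z. Phi p \<theta> z = 0}"
  then have "z = graph_point \<theta> p (abscissa \<theta> z)" by (simp add: graph_point_abscissa)
  then show "z \<in> range (graph_point \<theta> p)" by (rule range_eqI)
qed auto

lemma inj_graph_point: "inj (graph_point \<theta> p)"
  by (rule inj_on_inverseI[where g = "abscissa \<theta>"]) simp

lemma graph_point_polynomial:
  obtains a b where "\<And>x. graph_point \<theta> p x = (poly a x, poly b x)"
  by (rule that[of "[:0, cos \<theta>:] - smult (sin \<theta>) p" "[:0, sin \<theta>:] + smult (cos \<theta>) p"])
     (simp add: graph_point_def algebra_simps)

lemma C2_curve_polynomial: "C2_curve (\<lambda>x. (poly a x, poly b x))"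
proof -
  have "((\<lambda>x. (poly a x, poly b x)) has_vector_derivative
      (poly (pderiv a) x, poly (pderiv b) x)) (at x)" for a b :: "real poly" and x
    by (intro has_vector_derivative_Pair)
       (simp_all flip: has_real_derivative_iff_has_vector_derivative)
  moreover have "continuous_on UNIV (\<lambda>x. (poly a x, poly b x))" for a b :: "real poly"
    by (intro continuous_intros)
  ultimately show ?thesis
    unfolding C2_curve_def
    by (intro exI[of _ "\<lambda>x. (poly (pderiv a) x, poly (pderiv b) x)"]
        exI[of _ "\<lambda>x. (poly (pderiv (pderiv a)) x, poly (pderiv (pderiv b)) x)"]) simp
qed

lemma C2_curve_graph_point: "C2_curve (graph_point \<theta> p)"
proof -
  obtain a b where "\<And>x. graph_point \<theta> p x = (poly a x, poly b x)"
    using graph_point_polynomial[of \<theta> p] by blast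
  then have "graph_point \<theta> p = (\<lambda>x. (poly a x, poly b x))" by (rule ext)
  then show ?thesis by (simp add: C2_curve_polynomial)
qed

lemma Phi_along_graph:
  obtains f where "\<And>x. Phi q \<phi> (graph_point \<theta> p x) = poly f x"
proof -
  obtain a b where graph: "\<And>x. graph_point \<theta> p x = (poly a x, poly b x)"
    using graph_point_polynomial[of \<theta> p] by blast
  have "Phi q \<phi> (graph_point \<theta> p x) = poly (pcompose q (smult (cos \<phi>) a + smult (sin \<phi>) b)
      - (smult (cos \<phi>) b - smult (sin \<phi>) a)) x" for x
    unfolding graph Phi_def by (simp add: poly_pcompose algebra_simps)
  then show ?thesis by (rule that)
qed

lemma connected_Phi_vimage:
  assumes "convex S"
  shows "connected (Phi p \<theta> -` S)"
proof -
  define shifted where "shifted = (\<lambda>(x, y). graph_point \<theta> (p - [:y:]) x)"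
  have "Phi p \<theta> (shifted (x, y)) = y" for x y
    unfolding shifted_def Phi_eq by simp
  moreover have "z = shifted (abscissa \<theta> z, Phi p \<theta> z)" for z
    unfolding shifted_def by (simp add: graph_point_abscissa Phi_eq)
  ultimately have "Phi p \<theta> -` S = shifted ` (UNIV \<times> S)" by force
  moreover have "continuous_on (UNIV \<times> S) shifted"
    unfolding shifted_def graph_point_def case_prod_unfold by (auto intro!: continuous_intros)
  moreover have "connected ((UNIV :: real set) \<times> S)"
    by (intro convex_connected convex_Times convex_UNIV assms)
  ultimately show ?thesis using connected_continuous_image by metis
qed

lemma strictly_convex_if_second_derivative_pos:
  fixes f f' f'' :: "real \<Rightarrow> real"
  assumes f: "\<And>x. x \<in> {a..b} \<Longrightarrow> (f has_real_derivative f' x) (at x)"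
    and f': "\<And>x. x \<in> {a..b} \<Longrightarrow> (f' has_real_derivative f'' x) (at x)"
    and pos: "\<And>x. x \<in> {a..b} \<Longrightarrow> 0 < f'' x" and "a < b" "0 < l" "l < 1"
  shows "f ((1 - l) * a + l * b) < (1 - l) * f a + l * f b"
proof -
  define m where "m = (1 - l) * a + l * b"
  have gaps: "m - a = l * (b - a)" "b - m = (1 - l) * (b - a)"
    unfolding m_def by (simp_all add: algebra_simps)
  have "0 < m - a" "0 < b - m" unfolding gaps using assms(4-6) by simp_all
  then have m: "a < m" "m < b" by simp_all
  obtain y where y: "a < y" "y < m" "f m - f a = (m - a) * f' y"
    using MVT2[OF m(1), of f f'] f m by auto
  obtain z where z: "m < z" "z < b" "f b - f m = (b - m) * f' z"
    using MVT2[OF m(2), of f f'] f m by auto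
  have "f' y < f' z"
  proof (rule DERIV_pos_imp_increasing[of y z f'])
    show "\<exists>d. DERIV f' x :> d \<and> 0 < d" if "y \<le> x" "x \<le> z" for x
      using that y z f'[of x] pos[of x] by auto
  qed (use y z in simp)
  then have "0 < l * (1 - l) * (b - a) * (f' z - f' y)" using assms(4-6) by simp
  also have "\<dots> = l * (f b - f m) - (1 - l) * (f m - f a)"
    unfolding y(3) z(3) gaps by (simp add: algebra_simps)
  also have "\<dots> = (1 - l) * f a + l * f b - f m" by (simp add: algebra_simps)
  finally show ?thesis unfolding m_def by simp
qed

lemma
  fixes s t l :: real
  assumes "0 < l" "l < 1"
  shows min_less_convex_combination: "s \<noteq> t \<Longrightarrow> min s t < (1 - l) * s + l * t"
    and min_le_convex_combination: "min s t \<le> (1 - l) * s + l * t"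
proof -
  show less: "min s t < (1 - l) * s + l * t" if "s \<noteq> t"
  proof (cases "s < t")
    case True
    then have "0 < l * (t - s)" using assms(1) by simp
    then show ?thesis using True by (simp add: algebra_simps)
  next
    case False
    then have "0 < (1 - l) * (s - t)" using assms(2) that by simp
    then show ?thesis using False by (simp add: algebra_simps)
  qed
  have "(1 - l) * s + l * s = s" by (simp add: algebra_simps)
  then show "min s t \<le> (1 - l) * s + l * t" using less by (cases "s = t") auto
qed

lemma strictly_quasiconcave_on_above_graph:
  fixes x y :: "'a::real_vector \<Rightarrow> real"
  assumes linear: "linear x" "linear y" and inject: "\<And>z w. x z = x w \<Longrightarrow> y z = y w \<Longrightarrow> z = w"
    and "convex U" and strict: "\<And>a b l. \<lbrakk>a \<in> x ` U; b \<in> x ` U; a < b; 0 < l; l < 1\<rbrakk>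
      \<Longrightarrow> f ((1 - l) * a + l * b) < (1 - l) * f a + l * f b"
  shows "strictly_quasiconcave_on U (\<lambda>z. y z - f (x z))"
proof -
  let ?h = "\<lambda>z. y z - f (x z)"
  have "min (?h P) (?h Q) < ?h z" if PQ: "P \<in> U" "Q \<in> U" and z_in: "z \<in> open_segment P Q" for P Q z
  proof -
    obtain l where l: "P \<noteq> Q" "0 < l" "l < 1" and z: "z = (1 - l) *\<^sub>R P + l *\<^sub>R Q"
      using z_in by (auto simp: in_segment)
    have xz: "x z = (1 - l) * x P + l * x Q" and yz: "y z = (1 - l) * y P + l * y Q"
      unfolding z using linear by (simp_all add: linear_add linear_scale)
    show ?thesis
    proof (cases "x P = x Q")
      case True
      then have "?h z = (1 - l) * ?h P + l * ?h Q" unfolding xz yz by (simp add: algebra_simps)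
      moreover have "?h P \<noteq> ?h Q" using True inject l(1) by auto
      ultimately show ?thesis using min_less_convex_combination[OF l(2,3)] by simp
    next
      case False
      have "f (x z) < (1 - l) * f (x P) + l * f (x Q)"
        using False strict[of "x P" "x Q" l] strict[of "x Q" "x P" "1 - l"] PQ l(2,3)
        unfolding xz by (cases "x P" "x Q" rule: linorder_cases) (auto simp: add.commute)
      then have "(1 - l) * ?h P + l * ?h Q < ?h z" unfolding yz by (simp add: algebra_simps)
      with min_le_convex_combination[OF l(2,3)] show ?thesis by (rule le_less_trans)
    qed
  qed
  then show ?thesis unfolding strictly_quasiconcave_on_def using assms(4) by blast
qed

lemma strictly_quasiconcave_on_Phi:
  assumes "\<sigma> \<noteq> 0" "convex U" "\<And>x. x \<in> abscissa \<theta> ` U \<Longrightarrow> \<sigma> * poly (pderiv (pderiv p)) x < 0"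
  shows "strictly_quasiconcave_on U (\<lambda>z. \<sigma> * Phi p \<theta> z)"
proof -
  let ?q = "smult (- \<sigma>) p"
  have "strictly_quasiconcave_on U (\<lambda>z. - \<sigma> * ordinate \<theta> z - poly ?q (abscissa \<theta> z))"
  proof (rule strictly_quasiconcave_on_above_graph[OF linear_abscissa _ _ assms(2)])
    show "linear (\<lambda>z. - \<sigma> * ordinate \<theta> z)"
      using linear_ordinate[of \<theta>] by (simp add: linear_iff algebra_simps)
    show "z = w" if "abscissa \<theta> z = abscissa \<theta> w" "- \<sigma> * ordinate \<theta> z = - \<sigma> * ordinate \<theta> w" for z w
      using that assms(1) by (intro rotated_coordinates_inject[of \<theta>]) simp_all
    fix a b l :: real
    assume ab: "a \<in> abscissa \<theta> ` U" "b \<in> abscissa \<theta> ` U" "a < b" and l: "0 < l" "l < 1"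
    have "convex (abscissa \<theta> ` U)" by (rule convex_linear_image[OF linear_abscissa assms(2)])
    then have "{a..b} \<subseteq> abscissa \<theta> ` U"
      using ab by (simp add: connected_contains_Icc convex_connected)
    then have "0 < poly (pderiv (pderiv ?q)) x" if "x \<in> {a..b}" for x
      using assms(3)[of x] that by (auto simp: pderiv_smult pderiv_minus)
    then show "poly ?q ((1 - l) * a + l * b) < (1 - l) * poly ?q a + l * poly ?q b"
      by (rule strictly_convex_if_second_derivative_pos[OF poly_DERIV poly_DERIV _ ab(3) l])
  qed
  then show ?thesis by (simp add: Phi_eq algebra_simps)
qed

lemma fine_cell_linear_graph:
  assumes "pderiv (pderiv p) = 0" "point_or_open_interval I" "graph_point \<theta> p ` I \<subseteq> X"
  shows "fine_cell X (graph_point \<theta> p ` I)"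
proof -
  have "degree p \<le> 1" using assms(1) by (simp add: pderiv_eq_0_iff degree_pderiv)
  then obtain a b where "p = [:a, b:]"
    using degree0_coeffs degree1_coeffs by (metis le_Suc_eq One_nat_def le_zero_eq pCons_0_0)
  then have "graph_point \<theta> p x
      = (- a * sin \<theta>, a * cos \<theta>) + x *\<^sub>R (cos \<theta> - b * sin \<theta>, sin \<theta> + b * cos \<theta>)" for x
    by (simp add: graph_point_def algebra_simps)
  then have "graph_point \<theta> p ` I = (+) (- a * sin \<theta>, a * cos \<theta>) `
      (\<lambda>x. x *\<^sub>R (cos \<theta> - b * sin \<theta>, sin \<theta> + b * cos \<theta>)) ` I"
    by (simp add: image_image)
  moreover have "convex ((\<lambda>x. x *\<^sub>R (cos \<theta> - b * sin \<theta>, sin \<theta> + b * cos \<theta>)) ` I)"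
    by (intro convex_linear_image bounded_linear.linear bounded_linear_scaleR_left
        convex_point_or_open_interval assms(2))
  ultimately have "convex (graph_point \<theta> p ` I)" by (metis convex_translation)
  moreover have "is_cell (graph_point \<theta> p ` I)"
    by (rule is_cell_arc[OF continuous_on_C2_curve[OF C2_curve_graph_point] continuous_on_abscissa
          abscissa_graph_point assms(2)])
  ultimately show ?thesis using assms(3) by (intro fine_cell_convex)
qed

lemma contained_or_disjoint_subset:
  "contained_or_disjoint S X \<Longrightarrow> T \<subseteq> S \<Longrightarrow> contained_or_disjoint T X"
  unfolding contained_or_disjoint_def by blast

lemma ex_fine_parameters_curved_graph:
  assumes curved: "poly (pderiv (pderiv p)) x0 \<noteq> 0"
    and U: "open U" "convex U" "graph_point \<theta> p x0 \<in> U"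
    and X: "{z \<in> U. Phi p \<theta> z = 0} \<subseteq> X" "contained_or_disjoint {z \<in> U. 0 < Phi p \<theta> z} X"
      "contained_or_disjoint {z \<in> U. Phi p \<theta> z < 0} X"
  shows "\<exists>T. x0 \<in> T \<and> fine_parameters X (graph_point \<theta> p) T"
proof -
  define \<sigma> where "\<sigma> = - poly (pderiv (pderiv p)) x0"
  have "open {x. \<sigma> * poly (pderiv (pderiv p)) x < 0}"
    by (intro open_Collect_less continuous_intros)
  moreover have "\<sigma> * poly (pderiv (pderiv p)) x0 < 0"
    using curved by (auto simp: \<sigma>_def zero_less_mult_iff)
  ultimately obtain r where r: "0 < r" "ball x0 r \<subseteq> {x. \<sigma> * poly (pderiv (pderiv p)) x < 0}"
    using open_contains_ball by blast
  define V where "V = U \<inter> abscissa \<theta> -` ball x0 r"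
  have "open V" unfolding V_def
    by (intro open_Int open_vimage U(1) open_ball continuous_on_abscissa)
  have "convex V" unfolding V_def
    by (intro convex_Int U(2) convex_linear_vimage linear_abscissa convex_ball)
  have "\<sigma> \<noteq> 0" using curved by (simp add: \<sigma>_def)
  interpret level_curve "graph_point \<theta> p" "abscissa \<theta>" "\<lambda>z. \<sigma> * Phi p \<theta> z" V
  proof
    show "strictly_quasiconcave_on V (\<lambda>z. \<sigma> * Phi p \<theta> z)"
      using r(2) by (intro strictly_quasiconcave_on_Phi \<open>\<sigma> \<noteq> 0\<close> \<open>convex V\<close>) (auto simp: V_def)
    show "continuous_on V (\<lambda>z. \<sigma> * Phi p \<theta> z)"
      by (intro continuous_intros continuous_on_Phi)
  qed (use \<open>\<sigma> \<noteq> 0\<close> \<open>open V\<close> in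
      \<open>simp_all add: C2_curve_graph_point continuous_on_abscissa graph_point_abscissa\<close>)
  show ?thesis
  proof (rule ex_fine_parameters)
    show "graph_point \<theta> p x0 \<in> V" using U(3) r(1) unfolding V_def by simp
    show "{z \<in> V. \<sigma> * Phi p \<theta> z = 0} \<subseteq> X" using X(1) \<open>\<sigma> \<noteq> 0\<close> unfolding V_def by auto
    have sides: "contained_or_disjoint {z \<in> V. 0 < Phi p \<theta> z} X"
      "contained_or_disjoint {z \<in> V. Phi p \<theta> z < 0} X"
      by (rule contained_or_disjoint_subset[OF X(2)], auto simp: V_def)
         (rule contained_or_disjoint_subset[OF X(3)], auto simp: V_def)
    show "contained_or_disjoint {z \<in> V. 0 < \<sigma> * Phi p \<theta> z} X"
      using sides \<open>\<sigma> \<noteq> 0\<close> by (cases "0 < \<sigma>") (simp_all add: zero_less_mult_iff)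
    show "contained_or_disjoint {z \<in> V. \<sigma> * Phi p \<theta> z < 0} X"
      using sides \<open>\<sigma> \<noteq> 0\<close> by (cases "0 < \<sigma>") (simp_all add: mult_less_0_iff)
  qed
qed

lemma ex_fine_parameters_linear_graph:
  assumes "pderiv (pderiv p) = 0" "open U" "graph_point \<theta> p x0 \<in> U" "{z \<in> U. Phi p \<theta> z = 0} \<subseteq> X"
  shows "\<exists>T. x0 \<in> T \<and> fine_parameters X (graph_point \<theta> p) T"
proof -
  have "open (graph_point \<theta> p -` U)"
    by (intro open_vimage assms(2) continuous_on_C2_curve C2_curve_graph_point)
  moreover have "graph_point \<theta> p ` I \<subseteq> X" if "I \<subseteq> graph_point \<theta> p -` U" for I
  proof -
    have "graph_point \<theta> p ` I \<subseteq> {z \<in> U. Phi p \<theta> z = 0}" using that by auto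
    then show ?thesis using assms(4) by simp
  qed
  ultimately have "fine_parameters X (graph_point \<theta> p) (graph_point \<theta> p -` U)"
    unfolding fine_parameters_def using fine_cell_linear_graph[OF assms(1)] by simp
  then show ?thesis using assms(3) by blast
qed

section \<open>Sets determined by the signs of polynomial half planes\<close>

lemma sgn_constant_on_connected:
  fixes f :: "'a::topological_space \<Rightarrow> real"
  assumes "connected S" "continuous_on S f" "\<And>x. x \<in> S \<Longrightarrow> f x \<noteq> 0" "x \<in> S" "y \<in> S"
  shows "sgn (f x) = sgn (f y)"
proof (rule ccontr)
  assume "sgn (f x) \<noteq> sgn (f y)"
  moreover have "f x \<noteq> 0" "f y \<noteq> 0" using assms(3-5) by auto
  ultimately have "0 \<in> {f x..f y} \<union> {f y..f x}" by (auto simp: sgn_if split: if_splits)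
  moreover have "connected (f ` S)" using assms(1,2) by (intro connected_continuous_image)
  then have "{f x..f y} \<subseteq> f ` S" "{f y..f x} \<subseteq> f ` S"
    using assms(4,5) connected_contains_Icc by blast+
  ultimately have "0 \<in> f ` S" by blast
  then show False using assms(3) by force
qed

lemma Phi_zero_iff_if_vanishes_on_graph:
  assumes vanishes: "\<And>x. Phi q \<phi> (graph_point \<theta> p x) = 0"
  shows "Phi q \<phi> z = 0 \<longleftrightarrow> Phi p \<theta> z = 0"
proof
  assume "Phi p \<theta> z = 0"
  then show "Phi q \<phi> z = 0" using vanishes graph_point_abscissa by metis
next
  assume z: "Phi q \<phi> z = 0"
  obtain f where f: "\<And>y. Phi p \<theta> (graph_point \<phi> q y) = poly f y"
    using Phi_along_graph by blast
  define k where "k x = abscissa \<phi> (graph_point \<theta> p x)" for x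
  have k: "graph_point \<phi> q (k x) = graph_point \<theta> p x" for x
    unfolding k_def by (rule graph_point_abscissa[OF vanishes])
  have "inj k"
    by (rule injI) (metis k abscissa_graph_point)
  then have "infinite (range k)" by (simp add: finite_image_iff infinite_UNIV_char_0)
  moreover have "poly f (k x) = 0" for x by (simp flip: f add: k)
  then have "range k \<subseteq> {y. poly f y = 0}" by auto
  ultimately have "f = 0" using poly_roots_finite finite_subset by blast
  then show "Phi p \<theta> z = 0" using f[of "abscissa \<phi> z"] graph_point_abscissa[OF z] by simp
qed

lemma sgn_Phi_cong_if_vanishes_on_graph:
  assumes vanishes: "\<And>x. Phi q \<phi> (graph_point \<theta> p x) = 0"
    and "sgn (Phi p \<theta> z) = sgn (Phi p \<theta> w)"
  shows "sgn (Phi q \<phi> z) = sgn (Phi q \<phi> w)"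
proof -
  note zero_iff = Phi_zero_iff_if_vanishes_on_graph[OF vanishes]
  have on_side: "sgn (Phi q \<phi> z) = sgn (Phi q \<phi> w)"
    if "convex S" "0 \<notin> S" "Phi p \<theta> z \<in> S" "Phi p \<theta> w \<in> S" for S
    by (rule sgn_constant_on_connected[OF connected_Phi_vimage[OF that(1)] continuous_on_Phi])
       (use that zero_iff in auto)
  consider "Phi p \<theta> z = 0" "Phi p \<theta> w = 0" | "0 < Phi p \<theta> z" "0 < Phi p \<theta> w"
    | "Phi p \<theta> z < 0" "Phi p \<theta> w < 0"
    using assms(2) by (auto simp: sgn_if split: if_splits)
  then show ?thesis
  proof cases
    assume "Phi p \<theta> z = 0" "Phi p \<theta> w = 0"
    then show ?thesis using zero_iff[of z] zero_iff[of w] by simp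
  next
    assume "0 < Phi p \<theta> z" "0 < Phi p \<theta> w"
    then show ?thesis by (intro on_side[of "{0<..}"]) simp_all
  next
    assume "Phi p \<theta> z < 0" "Phi p \<theta> w < 0"
    then show ?thesis by (intro on_side[of "{..<0}"]) simp_all
  qed
qed

definition same_signs :: "(real poly \<times> real) set \<Rightarrow> real \<times> real \<Rightarrow> real \<times> real \<Rightarrow> bool" where
  "same_signs Q z w \<longleftrightarrow> (\<forall>(q, \<phi>)\<in>Q. sgn (Phi q \<phi> z) = sgn (Phi q \<phi> w))"

definition sgn_determined :: "(real poly \<times> real) set \<Rightarrow> (real \<times> real) set \<Rightarrow> bool" where
  "sgn_determined Q X \<longleftrightarrow> (\<forall>z w. same_signs Q z w \<longrightarrow> (z \<in> X \<longleftrightarrow> w \<in> X))"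

definition zero_curves :: "(real poly \<times> real) set \<Rightarrow> (real \<times> real) set" where
  "zero_curves Q = (\<Union>(q, \<phi>)\<in>Q. {z. Phi q \<phi> z = 0})"

lemma sgn_determined_basic_set: "sgn_determined (set eqs \<union> set ineqs) (basic_set eqs ineqs)"
proof -
  have "w \<in> basic_set eqs ineqs"
    if same: "same_signs (set eqs \<union> set ineqs) z w \<or> same_signs (set eqs \<union> set ineqs) w z"
      and z: "z \<in> basic_set eqs ineqs" for z w
  proof -
    have sgn_eq: "sgn (Phi q \<phi> z) = sgn (Phi q \<phi> w)" if "(q, \<phi>) \<in> set eqs \<union> set ineqs" for q \<phi>
      using same that unfolding same_signs_def by force
    have "Phi q \<phi> w = 0" if "(q, \<phi>) \<in> set eqs" for q \<phi>
      using sgn_eq[of q \<phi>] that z unfolding basic_set_def by (auto simp: sgn_0_0)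
    moreover have "0 < Phi q \<phi> w" if "(q, \<phi>) \<in> set ineqs" for q \<phi>
      using sgn_eq[of q \<phi>] that z unfolding basic_set_def by (auto simp: sgn_if split: if_splits)
    ultimately show ?thesis unfolding basic_set_def by auto
  qed
  then show ?thesis unfolding sgn_determined_def by blast
qed

lemma sgn_determined_Union:
  assumes "\<And>i. i \<in> I \<Longrightarrow> sgn_determined (Q i) (X i)"
  shows "sgn_determined (\<Union>i\<in>I. Q i) (\<Union>i\<in>I. X i)"
proof -
  have "z \<in> X i \<longleftrightarrow> w \<in> X i" if "same_signs (\<Union>i\<in>I. Q i) z w" "i \<in> I" for z w i
  proof -
    have "same_signs (Q i) z w" using that unfolding same_signs_def by blast
    then show ?thesis using assms[OF that(2)] unfolding sgn_determined_def by blast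
  qed
  then show ?thesis unfolding sgn_determined_def by blast
qed

lemma closed_zero_curves: "finite Q \<Longrightarrow> closed (zero_curves Q)"
  unfolding zero_curves_def
  by (intro closed_UN) (auto intro!: closed_Collect_eq continuous_on_Phi)

lemma open_same_signs:
  assumes "finite Q" "z \<notin> zero_curves Q"
  shows "open {w. same_signs Q z w}"
proof -
  have "open (\<Inter>(q, \<phi>)\<in>Q. {w. 0 < Phi q \<phi> z * Phi q \<phi> w})"
    using assms(1) by (intro open_INT ballI)
      (auto intro!: open_Collect_less continuous_intros continuous_on_Phi)
  moreover have "sgn (Phi q \<phi> z) = sgn (Phi q \<phi> w) \<longleftrightarrow> 0 < Phi q \<phi> z * Phi q \<phi> w"
    if "(q, \<phi>) \<in> Q" for q \<phi> w
  proof -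
    have "Phi q \<phi> z \<noteq> 0" using assms(2) that unfolding zero_curves_def by blast
    then show ?thesis by (auto simp: sgn_if zero_less_mult_iff)
  qed
  then have "{w. same_signs Q z w} = (\<Inter>(q, \<phi>)\<in>Q. {w. 0 < Phi q \<phi> z * Phi q \<phi> w})"
    unfolding same_signs_def by auto
  ultimately show ?thesis by simp
qed

lemma open_off_zero_curves:
  assumes "finite Q" "sgn_determined Q X"
  shows "open (X - zero_curves Q)"
proof (subst open_subopen, intro ballI exI conjI)
  fix z assume z: "z \<in> X - zero_curves Q"
  then show "open {w. same_signs Q z w}" using open_same_signs[OF assms(1)] by simp
  show "z \<in> {w. same_signs Q z w}" unfolding same_signs_def by auto
  show "{w. same_signs Q z w} \<subseteq> X - zero_curves Q"
  proof
    fix w assume w: "w \<in> {w. same_signs Q z w}"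
    then have "w \<in> X" using assms(2) z unfolding sgn_determined_def by blast
    moreover have "Phi q \<phi> w \<noteq> 0" if "(q, \<phi>) \<in> Q" for q \<phi>
    proof -
      have "sgn (Phi q \<phi> z) = sgn (Phi q \<phi> w)" using w that unfolding same_signs_def by blast
      moreover have "Phi q \<phi> z \<noteq> 0" using z that unfolding zero_curves_def by blast
      ultimately show ?thesis by (metis sgn_0_0)
    qed
    ultimately show "w \<in> X - zero_curves Q" unfolding zero_curves_def by blast
  qed
qed

definition exceptional :: "(real poly \<times> real) set \<Rightarrow> real poly \<Rightarrow> real \<Rightarrow> real set" where
  "exceptional Q p \<theta> =
     (\<Union>(q, \<phi>)\<in>Q. {x. Phi q \<phi> (graph_point \<theta> p x) = 0 \<and> (\<exists>y. Phi q \<phi> (graph_point \<theta> p y) \<noteq> 0)})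
     \<union> {x. poly (pderiv (pderiv p)) x = 0 \<and> pderiv (pderiv p) \<noteq> 0}"

lemma finite_exceptional:
  assumes "finite Q"
  shows "finite (exceptional Q p \<theta>)"
proof -
  have "finite {x. Phi q \<phi> (graph_point \<theta> p x) = 0 \<and> (\<exists>y. Phi q \<phi> (graph_point \<theta> p y) \<noteq> 0)}" for q \<phi>
  proof -
    obtain f where f: "\<And>x. Phi q \<phi> (graph_point \<theta> p x) = poly f x" using Phi_along_graph by blast
    show ?thesis using poly_roots_finite[of f] by (cases "f = 0") (simp_all add: f)
  qed
  moreover have "finite {x. poly (pderiv (pderiv p)) x = 0 \<and> pderiv (pderiv p) \<noteq> 0}"
    using poly_roots_finite[of "pderiv (pderiv p)"] by (cases "pderiv (pderiv p) = 0") simp_all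
  ultimately show ?thesis unfolding exceptional_def using assms by auto
qed

lemma sgn_Phi_determines_locally:
  assumes "finite Q" "sgn_determined Q X" "x0 \<notin> exceptional Q p \<theta>"
  obtains R where "0 < R" "\<And>z w. \<lbrakk>z \<in> ball (graph_point \<theta> p x0) R; w \<in> ball (graph_point \<theta> p x0) R;
      sgn (Phi p \<theta> z) = sgn (Phi p \<theta> w)\<rbrakk> \<Longrightarrow> z \<in> X \<longleftrightarrow> w \<in> X"
proof -
  let ?z0 = "graph_point \<theta> p x0"
  define T where "T = {(q, \<phi>) \<in> Q. Phi q \<phi> ?z0 \<noteq> 0}"
  have "finite T" unfolding T_def by (rule finite_subset[OF _ assms(1)]) auto
  moreover have "?z0 \<notin> zero_curves T" unfolding T_def zero_curves_def by auto
  ultimately have "open {w. same_signs T ?z0 w}" by (rule open_same_signs)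
  moreover have "?z0 \<in> {w. same_signs T ?z0 w}" unfolding same_signs_def by auto
  ultimately obtain R where R: "0 < R" "ball ?z0 R \<subseteq> {w. same_signs T ?z0 w}"
    using open_contains_ball by blast
  show ?thesis
  proof (rule that[OF R(1)])
    fix z w assume zw: "z \<in> ball ?z0 R" "w \<in> ball ?z0 R" "sgn (Phi p \<theta> z) = sgn (Phi p \<theta> w)"
    have "sgn (Phi q \<phi> z) = sgn (Phi q \<phi> w)" if q: "(q, \<phi>) \<in> Q" for q \<phi>
    proof (cases "Phi q \<phi> ?z0 = 0")
      case True
      then have "Phi q \<phi> (graph_point \<theta> p x) = 0" for x
        using assms(3) q unfolding exceptional_def by auto
      then show ?thesis using zw(3) by (rule sgn_Phi_cong_if_vanishes_on_graph)
    next
      case False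
      then have "(q, \<phi>) \<in> T" using q unfolding T_def by simp
      then have "sgn (Phi q \<phi> ?z0) = sgn (Phi q \<phi> v)" if "v \<in> ball ?z0 R" for v
        using R(2) that unfolding same_signs_def by blast
      then show ?thesis using zw(1,2) by metis
    qed
    then show "z \<in> X \<longleftrightarrow> w \<in> X"
      using assms(2) unfolding sgn_determined_def same_signs_def by blast
  qed
qed

lemma ex_fine_parameters_off_exceptional:
  assumes "finite Q" "sgn_determined Q X" and x0: "x0 \<notin> exceptional Q p \<theta>" "graph_point \<theta> p x0 \<in> X"
  shows "\<exists>T. x0 \<in> T \<and> fine_parameters X (graph_point \<theta> p) T"
proof -
  obtain R where R: "0 < R" and same: "\<And>z w. \<lbrakk>z \<in> ball (graph_point \<theta> p x0) R;
      w \<in> ball (graph_point \<theta> p x0) R; sgn (Phi p \<theta> z) = sgn (Phi p \<theta> w)\<rbrakk> \<Longrightarrow> z \<in> X \<longleftrightarrow> w \<in> X"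
    using sgn_Phi_determines_locally[OF assms(1,2) x0(1)] by blast
  let ?U = "ball (graph_point \<theta> p x0) R"
  have "graph_point \<theta> p x0 \<in> ?U" using R by simp
  then have on: "{z \<in> ?U. Phi p \<theta> z = 0} \<subseteq> X"
    using same[of _ "graph_point \<theta> p x0"] x0(2) by auto
  have "contained_or_disjoint {z \<in> ?U. sgn (Phi p \<theta> z) = s} X" for s
    unfolding contained_or_disjoint_def using same by blast
  from this[of 1] this[of "- 1"]
  have sides: "contained_or_disjoint {z \<in> ?U. 0 < Phi p \<theta> z} X"
    "contained_or_disjoint {z \<in> ?U. Phi p \<theta> z < 0} X"
    by (simp_all only: sgn_1_pos sgn_1_neg)
  consider "poly (pderiv (pderiv p)) x0 \<noteq> 0" | "pderiv (pderiv p) = 0"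
    using x0(1) unfolding exceptional_def by auto
  then show ?thesis
  proof cases
    assume "poly (pderiv (pderiv p)) x0 \<noteq> 0"
    then show ?thesis
      by (rule ex_fine_parameters_curved_graph[OF _ open_ball convex_ball \<open>_ \<in> ?U\<close> on sides])
  next
    assume "pderiv (pderiv p) = 0"
    then show ?thesis
      by (rule ex_fine_parameters_linear_graph[OF _ open_ball \<open>_ \<in> ?U\<close> on])
  qed
qed

lemma decomposable_graph:
  assumes "finite Q" "sgn_determined Q X" "open W"
  shows "decomposable (fine_cell X) (X \<inter> {z. Phi p \<theta> z = 0} \<inter> W)"
proof -
  let ?c = "graph_point \<theta> p"
  define \<T> where "\<T> = {T. fine_parameters X ?c T \<and> T \<subseteq> ?c -` W}"
  define S where "S = ?c -` (X \<inter> W)"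
  have "decomposable (\<lambda>I. fine_cell X (?c ` I)) (\<Union>\<T>)"
    by (rule decomposable_open_real) (auto simp: \<T>_def fine_parameters_def)
  then have fine: "decomposable (fine_cell X) (?c ` \<Union>\<T>)"
    by (rule decomposable_image[OF _ inj_graph_point])
  have "S - \<Union>\<T> \<subseteq> exceptional Q p \<theta>"
  proof (rule subsetI, rule ccontr)
    fix x assume x: "x \<in> S - \<Union>\<T>" "x \<notin> exceptional Q p \<theta>"
    then obtain T where T: "x \<in> T" "fine_parameters X ?c T"
      using ex_fine_parameters_off_exceptional[OF assms(1,2) x(2)] unfolding S_def by blast
    have "open (?c -` W)"
      by (intro open_vimage assms(3) continuous_on_C2_curve C2_curve_graph_point)
    then have "T \<inter> ?c -` W \<in> \<T>" unfolding \<T>_def using fine_parameters_Int[OF T(2)] by simp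
    then show False using x(1) T(1) unfolding S_def by blast
  qed
  then have "finite (S - \<Union>\<T>)" using finite_exceptional[OF assms(1)] by (rule finite_subset)
  then have "decomposable (fine_cell X) (?c ` (S - \<Union>\<T>))"
    by (intro decomposable_countable fine_cell_point) (auto simp: S_def intro: countable_finite)
  then have "decomposable (fine_cell X) (?c ` \<Union>\<T> \<union> ?c ` (S - \<Union>\<T>))"
    by (rule decomposable_Un[OF fine]) (simp flip: image_Int[OF inj_graph_point])
  moreover have "\<Union>\<T> \<subseteq> S"
    using fine_parameters_image_subset unfolding \<T>_def S_def by blast
  then have "?c ` \<Union>\<T> \<union> ?c ` (S - \<Union>\<T>) = ?c ` S" by blast
  moreover have "?c ` S = X \<inter> {z. Phi p \<theta> z = 0} \<inter> W"
    unfolding S_def image_vimage_eq range_graph_point by blast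
  ultimately show ?thesis by simp
qed

lemma decomposable_zero_curves:
  assumes "finite Q" "sgn_determined Q X" "finite T"
  shows "decomposable (fine_cell X) (X \<inter> zero_curves T)"
  using assms(3)
proof (induction T rule: finite_induct)
  case empty
  have "decomposable (fine_cell X) {}" by (rule decomposable_countable) simp_all
  then show ?case unfolding zero_curves_def by simp
next
  case (insert r T)
  obtain p \<theta> where r: "r = (p, \<theta>)" by fastforce
  have "X \<inter> zero_curves (insert r T)
      = (X \<inter> zero_curves T) \<union> (X \<inter> {z. Phi p \<theta> z = 0} \<inter> - zero_curves T)"
    unfolding r zero_curves_def by auto
  moreover have "decomposable (fine_cell X) (X \<inter> {z. Phi p \<theta> z = 0} \<inter> - zero_curves T)"
    by (rule decomposable_graph[OF assms(1,2)])
       (simp add: open_Compl closed_zero_curves insert.hyps(1))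
  ultimately show ?case using decomposable_Un[OF insert.IH] by auto
qed

lemma decomposable_sgn_determined:
  assumes "finite Q" "sgn_determined Q X"
  shows "decomposable (fine_cell X) X"
proof -
  have "decomposable (fine_cell X) (X - zero_curves Q)"
    by (rule decomposable_open_subset[OF open_off_zero_curves[OF assms]]) simp
  moreover have "decomposable (fine_cell X) (X \<inter> zero_curves Q)"
    by (rule decomposable_zero_curves[OF assms assms(1)])
  ultimately have "decomposable (fine_cell X) ((X - zero_curves Q) \<union> (X \<inter> zero_curves Q))"
    by (rule decomposable_Un) auto
  then show ?thesis by (simp add: Un_Diff_Int)
qed

theorem theorem4p10:
  fixes F :: "((real poly \<times> real) list \<times> (real poly \<times> real) list) set"
    and X :: "(real \<times> real) set"
  assumes "finite F"
    and "X = (\<Union>(eqs, ineqs)\<in>F. basic_set eqs ineqs)"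
  shows "\<exists>C. cell_decomposition C X \<and>
           (\<forall>A\<in>X. \<forall>B\<in>X. \<forall>\<gamma>. shortest_curve X A B \<gamma> \<longrightarrow> (\<forall>e\<in>C. interacts_finitely \<gamma> e))"
proof -
  define Q where "Q = (\<Union>(eqs, ineqs)\<in>F. set eqs \<union> set ineqs)"
  have "finite Q" unfolding Q_def using assms(1) by auto
  moreover have "sgn_determined Q X"
    unfolding Q_def assms(2) by (rule sgn_determined_Union) (auto simp: sgn_determined_basic_set)
  ultimately have "decomposable (fine_cell X) X" by (rule decomposable_sgn_determined)
  then obtain C where "countable C" "disjoint C" "\<Union>C = X" "\<forall>e\<in>C. fine_cell X e"
    unfolding decomposable_def by blast
  then show ?thesis
    unfolding cell_decomposition_def fine_cell_def by (intro exI[of _ C]) auto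
qed

end
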